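(* Let $(\mathbf{B},\|\cdot\|)$ be a real separable Banach space. Let $1\le p<2$ and let $\{b_n;\,n\ge1\}$ be an increasing sequence of positive real numbers such that $\{b_n/n^{1/p};\,n\ge1\}$ is a nondecreasing sequence. If $\mathbf{B}$ is of Rademacher type $p$, then, for every sequence $\{X,X_n;\,n\ge1\}$ of i.i.d. $\mathbf{B}$-valued random variables, with $S_n=\sum_{i=1}^nX_i$ and $\gamma_n=n\,\mathbb{E}\left(XI\{\|X\|\le b_n\}\right)$, $n\ge1$: (a) $\lim_{n\to\infty}\dfrac{S_n-\gamma_n}{b_n}=0$ a.s. if and only if $\sum_{n=1}^\infty\mathbb{P}(\|X\|>b_n)<\infty$; and (b) $\limsup_{n\to\infty}\dfrac{\|S_n-\gamma_n\|}{b_n}=\infty$ a.s. if and only if $\sum_{n=1}^\infty\mathbb{P}(\|X\|>b_n)=\infty$.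
   Context: A $\mathbf{B}$-valued random variable is a Borel measurable map from a probability space into $\mathbf{B}$. A sequence $\{X,X_n;\,n\ge1\}$ of i.i.d. $\mathbf{B}$-valued random variables means that the $X_n$ are independent and each has the same distribution as $X$. "a.s." means almost surely, $I\{\cdot\}$ is the indicator function, and the expectation of a $\mathbf{B}$-valued random variable is the Bochner integral. "Increasing" means strictly increasing (as opposed to "nondecreasing"). Let $\{R_n;\,n\ge1\}$ be a Rademacher sequence, i.e. i.i.d. real random variables with $\mathbb{P}(R_n=1)=\mathbb{P}(R_n=-1)=1/2$, and let $\mathcal{C}(\mathbf{B})$ be the set of sequences $(v_1,v_2,\ldots)\in\mathbf{B}\times\mathbf{B}\times\cdots$ such that $\sum_{n=1}^\infty R_nv_n$ converges in probability. For $1\le p\le2$, $\mathbf{B}$ is said to be of Rademacher type $p$ if there exists a constant $0<C<\infty$ such that $\mathbb{E}\left\|\sum_{n=1}^\infty R_nv_n\right\|^p\le C\sum_{n=1}^\infty\|v_n\|^p$ for all $(v_1,v_2,\ldots)\in\mathcal{C}(\mathbf{B})$. *)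

theory Defs
  imports "HOL-Probability.Probability"
begin

text \<open>
  All sequences are indexed by the integers \<open>n \<ge> 1\<close>, although they are represented by
  functions on type \<open>nat\<close>; the value at \<open>0\<close> is never used.
\<close>

definition tendsto_in_prob ::
  "'w measure \<Rightarrow> (nat \<Rightarrow> 'w \<Rightarrow> 'b::{banach, second_countable_topology}) \<Rightarrow> ('w \<Rightarrow> 'b) \<Rightarrow> bool"
  where "tendsto_in_prob N Y Z \<longleftrightarrow>
    (\<forall>n. Y n \<in> borel_measurable N) \<and> Z \<in> borel_measurable N \<and>
    (\<forall>\<epsilon>>0. (\<lambda>n. measure N {\<omega> \<in> space N. norm (Y n \<omega> - Z \<omega>) > \<epsilon>}) \<longlonglongrightarrow> 0)"

definition rademacher_sequence :: "'w measure \<Rightarrow> (nat \<Rightarrow> 'w \<Rightarrow> real) \<Rightarrow> bool"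
  where "rademacher_sequence N R \<longleftrightarrow>
    prob_space N \<and> prob_space.indep_vars N (\<lambda>_. borel) R {1..} \<and>
    (\<forall>n\<ge>1. measure N {\<omega> \<in> space N. R n \<omega> = 1} = 1/2 \<and>
           measure N {\<omega> \<in> space N. R n \<omega> = -1} = 1/2)"

text \<open>\<open>S\<close> is a version of the sum in probability of the series \<open>\<Sum>n\<ge>1. R n v n\<close>;
  it is determined almost surely.\<close>

definition rademacher_sum ::
  "'w measure \<Rightarrow> (nat \<Rightarrow> 'w \<Rightarrow> real) \<Rightarrow> (nat \<Rightarrow> 'b::{banach, second_countable_topology}) \<Rightarrow>
   ('w \<Rightarrow> 'b) \<Rightarrow> bool"
  where "rademacher_sum N R v S \<longleftrightarrow>
    tendsto_in_prob N (\<lambda>n \<omega>. \<Sum>i=1..n. R i \<omega> *\<^sub>R v i) S"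

definition rademacher_convergent ::
  "'w measure \<Rightarrow> (nat \<Rightarrow> 'w \<Rightarrow> real) \<Rightarrow> (nat \<Rightarrow> 'b::{banach, second_countable_topology}) set"
  where "rademacher_convergent N R = {v. \<exists>S. rademacher_sum N R v S}"

text \<open>
  Rademacher type of the Banach space \<open>'b\<close>, expressed through a given Rademacher sequence
  \<open>R\<close> on \<open>N\<close>. Both sides of the inequality take values in \<open>[0, \<infinity>]\<close>.
\<close>

definition rademacher_type ::
  "'w measure \<Rightarrow> (nat \<Rightarrow> 'w \<Rightarrow> real) \<Rightarrow> 'b::{banach, second_countable_topology} itself \<Rightarrow>
   real \<Rightarrow> bool"
  where "rademacher_type N R (_ :: 'b itself) p \<longleftrightarrow>
    1 \<le> p \<and> p \<le> 2 \<and>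
    (\<exists>C::real. 0 < C \<and>
      (\<forall>v \<in> (rademacher_convergent N R :: (nat \<Rightarrow> 'b) set). \<forall>S. rademacher_sum N R v S \<longrightarrow>
        (\<integral>\<^sup>+\<omega>. ennreal (norm (S \<omega>) powr p) \<partial>N)
          \<le> ennreal C * (\<Sum>n. ennreal (norm (v (Suc n)) powr p))))"

definition iid_sequence ::
  "'a measure \<Rightarrow> ('a \<Rightarrow> 'b::{banach, second_countable_topology}) \<Rightarrow> (nat \<Rightarrow> 'a \<Rightarrow> 'b) \<Rightarrow> bool"
  where "iid_sequence M X Xs \<longleftrightarrow>
    prob_space M \<and> X \<in> borel_measurable M \<and>
    prob_space.indep_vars M (\<lambda>_. borel) Xs {1..} \<and>
    (\<forall>n\<ge>1. distr M borel (Xs n) = distr M borel X)"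

definition partial_sum :: "(nat \<Rightarrow> 'a \<Rightarrow> 'b::real_normed_vector) \<Rightarrow> nat \<Rightarrow> 'a \<Rightarrow> 'b"
  where "partial_sum Xs n \<omega> = (\<Sum>i=1..n. Xs i \<omega>)"

definition centering ::
  "'a measure \<Rightarrow> ('a \<Rightarrow> 'b::{banach, second_countable_topology}) \<Rightarrow> (nat \<Rightarrow> real) \<Rightarrow> nat \<Rightarrow> 'b"
  where "centering M X b n =
    real n *\<^sub>R (\<integral>\<omega>. indicator {\<omega>. norm (X \<omega>) \<le> b n} \<omega> *\<^sub>R X \<omega> \<partial>M)"

end

theory Submission
  imports Defs
begin

text \<open>
  Let \<open>\<kappa>(x)\<close> be the number of \<open>n \<ge> 1\<close> with \<open>b\<^sub>n < x\<close>; then \<open>\<Sum> P(\<parallel>X\<parallel> > b\<^sub>n) = E \<kappa>(\<parallel>X\<parallel>)\<close>, and the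
  growth of \<open>b\<close> turns all moment conditions into pointwise bounds by \<open>\<kappa>\<close>.

  If \<open>E \<kappa>(\<parallel>X\<parallel>) < \<infinity>\<close>, truncate \<open>X\<^sub>i\<close> at \<open>b\<^sub>i\<close>, and let \<open>T\<^sub>n\<close> be the centered sum of the truncated
  variables. Type \<open>p\<close>, applied after a finite-range approximation, yields \<open>E \<parallel>T\<^sub>n\<parallel> = o(b\<^sub>n)\<close>. The real
  random variable \<open>\<parallel>T\<^sub>n\<parallel>\<close> has variance at most the sum of the second moments of the summands, in any
  Banach space, and \<open>\<Sum> E \<parallel>Y\<^sub>i\<parallel>\<^sup>2 / b\<^sub>i\<^sup>2 < \<infinity>\<close> for the truncated variables \<open>Y\<^sub>i\<close> because \<open>p < 2\<close>. Chebyshev's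
  inequality, Etemadi's maximal inequality and the Borel-Cantelli lemma on blocks on which \<open>b\<close> doubles give
  \<open>T\<^sub>n / b\<^sub>n \<rightarrow> 0\<close> almost surely.

  Conversely, \<open>\<parallel>S\<^sub>n - \<gamma>\<^sub>n\<parallel> \<le> K b\<^sub>n\<close> for all large \<open>n\<close> forces \<open>\<parallel>X\<^sub>n - c\<^sub>n\<parallel> \<le> 2 K b\<^sub>n\<close> for all large \<open>n\<close>, where
  \<open>c\<^sub>n = \<gamma>\<^sub>n - \<gamma>\<^bsub>n-1\<^esub>\<close>. If this has positive probability, then \<open>\<Sum> P(\<parallel>X - c\<^sub>n\<parallel> > 2 K b\<^sub>n) < \<infinity>\<close> by the second
  Borel-Cantelli lemma, which bounds \<open>c\<^sub>n\<close> by a multiple of \<open>b\<^sub>n\<close> and leads to \<open>E \<kappa>(\<parallel>X\<parallel>) < \<infinity>\<close>.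
\<close>

section \<open>Independent sums in Banach spaces\<close>

lemma (in prob_space) indep_var_sums:
  fixes Z :: "'i \<Rightarrow> 'a \<Rightarrow> 'b::{second_countable_topology, real_normed_vector}"
  assumes "indep_vars (\<lambda>_. borel) Z I" "A \<inter> B = {}" "A \<subseteq> I" "B \<subseteq> I"
  shows "indep_var borel (\<lambda>\<omega>. \<Sum>i\<in>A. Z i \<omega>) borel (\<lambda>\<omega>. \<Sum>i\<in>B. Z i \<omega>)"
proof -
  have "indep_var
      borel ((\<lambda>f. \<Sum>i\<in>A. f i) \<circ> (\<lambda>\<omega>. restrict (\<lambda>i. Z i \<omega>) A))
      borel ((\<lambda>f. \<Sum>i\<in>B. f i) \<circ> (\<lambda>\<omega>. restrict (\<lambda>i. Z i \<omega>) B))"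
    using assms by (intro indep_var_compose[OF indep_var_restrict]) auto
  then show ?thesis
    by (simp add: comp_def cong: sum.cong)
qed

text \<open>Independence makes the joint law a product, so Tonelli lets \<open>V\<close> be
  integrated out while \<open>U\<close> stays frozen.\<close>

lemma (in prob_space) nn_integral_indep_var:
  assumes "indep_var S U T V" and f[measurable]: "f \<in> borel_measurable (S \<Otimes>\<^sub>M T)"
  shows "(\<integral>\<^sup>+\<omega>. f (U \<omega>, V \<omega>) \<partial>M) = (\<integral>\<^sup>+\<omega>. (\<integral>\<^sup>+\<omega>'. f (U \<omega>, V \<omega>') \<partial>M) \<partial>M)"
proof -
  have [measurable]: "U \<in> measurable M S" "V \<in> measurable M T"
    and eq: "distr M S U \<Otimes>\<^sub>M distr M T V = distr M (S \<Otimes>\<^sub>M T) (\<lambda>x. (U x, V x))"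
    using assms by (auto simp: indep_var_distribution_eq)
  interpret V: prob_space "distr M T V" by (rule prob_space_distr) simp
  have "(\<integral>\<^sup>+\<omega>. f (U \<omega>, V \<omega>) \<partial>M) = (\<integral>\<^sup>+z. f z \<partial>(distr M S U \<Otimes>\<^sub>M distr M T V))"
    unfolding eq by (simp add: nn_integral_distr)
  also have "\<dots> = (\<integral>\<^sup>+x. \<integral>\<^sup>+y. f (x, y) \<partial>distr M T V \<partial>distr M S U)"
    by (subst V.nn_integral_fst[symmetric]) auto
  also have "\<dots> = (\<integral>\<^sup>+\<omega>. (\<integral>\<^sup>+\<omega>'. f (U \<omega>, V \<omega>') \<partial>M) \<partial>M)"
    by (subst nn_integral_distr)
      (auto intro!: nn_integral_cong nn_integral_distr)
  finally show ?thesis .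
qed

text \<open>Bias-variance identity. It yields the minimality of the variance among second moments
  and splits off the fluctuation of a conditional mean.\<close>

lemma (in prob_space) second_moment_about:
  fixes W :: "'a \<Rightarrow> real"
  assumes "integrable M W" "integrable M (\<lambda>\<omega>. (W \<omega>)\<^sup>2)"
  shows "expectation (\<lambda>\<omega>. (W \<omega> - a)\<^sup>2)
    = expectation (\<lambda>\<omega>. (W \<omega> - expectation W)\<^sup>2) + (expectation W - a)\<^sup>2"
  using assms by (simp add: power2_diff prob_space algebra_simps power2_eq_square)

lemma (in prob_space) integrable_bounded:
  fixes W :: "'a \<Rightarrow> 'b::{banach, second_countable_topology}"
  assumes "W \<in> borel_measurable M" "\<And>\<omega>. norm (W \<omega>) \<le> K"
  shows "integrable M W"
  using assms by (intro integrable_const_bound[of _ K]) auto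

lemma lipschitz_on_borel_measurable:
  assumes "L-lipschitz_on UNIV (f :: 'a::metric_space \<Rightarrow> 'b::metric_space)"
  shows "f \<in> borel_measurable borel"
  using assms by (intro borel_measurable_continuous_onI lipschitz_on_continuous_on)

text \<open>Tensorization of the variance: conditionally on the other summands, the variance
  contributed by \<open>Z j\<close> is at most the second moment about \<open>\<phi>\<close> evaluated with \<open>Z j\<close> removed.\<close>

lemma (in prob_space) variance_lipschitz_sum:
  fixes Z :: "'i \<Rightarrow> 'a \<Rightarrow> 'b::{banach, second_countable_topology}"
  assumes indep: "indep_vars (\<lambda>_. borel) Z I"
    and bdd: "\<And>i \<omega>. i \<in> I \<Longrightarrow> norm (Z i \<omega>) \<le> K"
    and "finite A" "A \<subseteq> I" "1-lipschitz_on UNIV \<phi>"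
  shows "variance (\<lambda>\<omega>. \<phi> (\<Sum>i\<in>A. Z i \<omega>)) \<le> (\<Sum>i\<in>A. expectation (\<lambda>\<omega>. (norm (Z i \<omega>))\<^sup>2))"
  using \<open>finite A\<close> \<open>A \<subseteq> I\<close> \<open>1-lipschitz_on UNIV \<phi>\<close>
proof (induction A arbitrary: \<phi> rule: finite_induct)
  case empty
  then show ?case by (simp add: prob_space)
next
  case (insert j A)
  define U where "U \<omega> = (\<Sum>i\<in>A. Z i \<omega>)" for \<omega>
  define V where "V = Z j"
  note lip = \<open>1-lipschitz_on UNIV \<phi>\<close>
  have [measurable]: "\<phi> \<in> borel_measurable borel"
    using lip by (rule lipschitz_on_borel_measurable)
  have [measurable]: "Z i \<in> borel_measurable M" if "i \<in> insert j A" for i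
    using indep that insert.prems(1) by (auto simp: indep_vars_def)
  have [measurable]: "U \<in> borel_measurable M" "V \<in> borel_measurable M"
    unfolding U_def V_def by measurable
  have Ubd: "norm (U \<omega>) \<le> real (card A) * K" for \<omega>
    unfolding U_def by (rule order_trans[OF norm_sum sum_bounded_above]) (use bdd insert.prems in auto)
  have Vbd: "norm (V \<omega>) \<le> K" for \<omega>
    using bdd insert.prems by (simp add: V_def)
  have iUV: "indep_var borel U borel V"
    using indep_var_sums[OF indep, of A "{j}"] insert by (simp add: U_def[abs_def] V_def)
  have lipD: "\<bar>\<phi> x - \<phi> y\<bar> \<le> norm (x - y)" for x y
    using lipschitz_onD[OF lip, of x y] by (simp add: dist_norm)
  have \<phi>bd: "\<bar>\<phi> x\<bar> \<le> \<bar>\<phi> 0\<bar> + norm x" for x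
    using lipD[of x 0] by simp
  have \<phi>sV: "\<bar>\<phi> (s + V \<omega>)\<bar> \<le> \<bar>\<phi> 0\<bar> + norm s + K" for s \<omega>
    using \<phi>bd[of "s + V \<omega>"] norm_triangle_ineq[of s "V \<omega>"] Vbd[of \<omega>] by linarith
  have int1: "integrable M (\<lambda>\<omega>. \<phi> (s + V \<omega>))" for s
    using \<phi>sV by (intro integrable_bounded[of _ "\<bar>\<phi> 0\<bar> + norm s + K"]) auto
  have int2: "integrable M (\<lambda>\<omega>. (\<phi> (s + V \<omega>))\<^sup>2)" for s
    by (intro integrable_bounded[of _ "(\<bar>\<phi> 0\<bar> + norm s + K)\<^sup>2"])
      (auto simp: abs_le_square_iff[symmetric] intro: order_trans[OF \<phi>sV])
  \<comment> \<open>\<open>\<psi>\<close> is the conditional mean of \<open>\<phi> (U + V)\<close>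
    given \<open>U\<close>. It is again 1-Lipschitz, so the induction hypothesis applies to it; this
    is why \<open>\<phi>\<close> is generalized in the induction.\<close>
  define \<psi> where "\<psi> s = expectation (\<lambda>\<omega>. \<phi> (s + V \<omega>))" for s
  have \<psi>lip: "1-lipschitz_on UNIV \<psi>"
  proof (rule lipschitz_onI)
    fix x y :: 'b
    have "\<bar>\<psi> x - \<psi> y\<bar> = \<bar>expectation (\<lambda>\<omega>. \<phi> (x + V \<omega>) - \<phi> (y + V \<omega>))\<bar>"
      unfolding \<psi>_def by (simp add: int1)
    also have "\<dots> \<le> expectation (\<lambda>\<omega>. \<bar>\<phi> (x + V \<omega>) - \<phi> (y + V \<omega>)\<bar>)"
      by (rule integral_abs_bound)
    also have "\<dots> \<le> expectation (\<lambda>\<omega>. norm (x - y))"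
    proof (rule integral_mono)
      show "\<bar>\<phi> (x + V \<omega>) - \<phi> (y + V \<omega>)\<bar> \<le> norm (x - y)" for \<omega>
        using lipD[of "x + V \<omega>" "y + V \<omega>"] by simp
    qed (use int1 in auto)
    finally show "dist (\<psi> x) (\<psi> y) \<le> 1 * dist x y"
      by (simp add: dist_norm prob_space)
  qed simp
  have [measurable]: "\<psi> \<in> borel_measurable borel"
    using \<psi>lip by (rule lipschitz_on_borel_measurable)
  define m where "m = expectation (\<lambda>\<omega>. \<psi> (U \<omega>))"
  \<comment> \<open>The second moment about \<open>m\<close> splits into the variance over
    \<open>V\<close> with \<open>s\<close> fixed, bounded through the reference value
    \<open>\<phi> s\<close>, and a bias term whose mean over \<open>s = U\<close> is a variance for
    the smaller sum.\<close>
  have inner: "expectation (\<lambda>\<omega>. (\<phi> (s + V \<omega>) - m)\<^sup>2) \<le> expectation (\<lambda>\<omega>. (norm (V \<omega>))\<^sup>2) + (\<psi> s - m)\<^sup>2" for s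
  proof -
    have "expectation (\<lambda>\<omega>. (\<phi> (s + V \<omega>) - \<psi> s)\<^sup>2) \<le> expectation (\<lambda>\<omega>. (\<phi> (s + V \<omega>) - \<phi> s)\<^sup>2)"
      using second_moment_about[OF int1 int2, of s "\<phi> s"] by (simp add: \<psi>_def)
    also have "\<dots> \<le> expectation (\<lambda>\<omega>. (norm (V \<omega>))\<^sup>2)"
    proof (rule integral_mono)
      have le: "\<bar>\<phi> (s + V \<omega>) - \<phi> s\<bar> \<le> norm (V \<omega>)" for \<omega>
        using lipD[of "s + V \<omega>" s] by simp
      then show le2: "(\<phi> (s + V \<omega>) - \<phi> s)\<^sup>2 \<le> (norm (V \<omega>))\<^sup>2" for \<omega>
        by (simp add: abs_le_square_iff[symmetric])
      show "integrable M (\<lambda>\<omega>. (norm (V \<omega>))\<^sup>2)"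
        by (intro integrable_bounded[of _ "K\<^sup>2"]) (auto intro!: power_mono Vbd)
      then show "integrable M (\<lambda>\<omega>. (\<phi> (s + V \<omega>) - \<phi> s)\<^sup>2)"
        by (rule Bochner_Integration.integrable_bound) (auto simp: le2)
    qed
    finally show ?thesis
      using second_moment_about[OF int1 int2, of s m] by (simp add: \<psi>_def)
  qed
  have bd1: "\<bar>\<phi> (U \<omega> + V \<omega>)\<bar> \<le> \<bar>\<phi> 0\<bar> + real (card A) * K + K" for \<omega>
    using \<phi>sV[of "U \<omega>" \<omega>] Ubd[of \<omega>] by linarith
  have i1: "integrable M (\<lambda>\<omega>. \<phi> (U \<omega> + V \<omega>))"
    using bd1 by (intro integrable_bounded[of _ "\<bar>\<phi> 0\<bar> + real (card A) * K + K"]) auto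
  have i2: "integrable M (\<lambda>\<omega>. (\<phi> (U \<omega> + V \<omega>))\<^sup>2)"
    by (intro integrable_bounded[of _ "(\<bar>\<phi> 0\<bar> + real (card A) * K + K)\<^sup>2"])
      (auto simp: abs_le_square_iff[symmetric] intro: order_trans[OF bd1])
  have \<psi>bd: "\<bar>\<psi> (U \<omega>) - m\<bar> \<le> \<bar>\<psi> 0\<bar> + real (card A) * K + \<bar>m\<bar>" for \<omega>
    using lipschitz_onD[OF \<psi>lip, of "U \<omega>" 0] Ubd[of \<omega>] by (simp add: dist_norm)
  have i3: "integrable M (\<lambda>\<omega>. (\<psi> (U \<omega>) - m)\<^sup>2)"
    by (intro integrable_bounded[of _ "(\<bar>\<psi> 0\<bar> + real (card A) * K + \<bar>m\<bar>)\<^sup>2"])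
      (auto simp: abs_le_square_iff[symmetric] intro: order_trans[OF \<psi>bd])
  have i5: "integrable M (\<lambda>\<omega>. (\<phi> (U \<omega> + V \<omega>) - m)\<^sup>2)"
    using i1 i2 by (simp add: power2_diff)
  have i4: "integrable M (\<lambda>\<omega>. (\<phi> (s + V \<omega>) - m)\<^sup>2)" for s
    using int1 int2 by (simp add: power2_diff)
  have "ennreal (variance (\<lambda>\<omega>. \<phi> (U \<omega> + V \<omega>)))
      \<le> ennreal (expectation (\<lambda>\<omega>. (\<phi> (U \<omega> + V \<omega>) - m)\<^sup>2))"
    using second_moment_about[OF i1 i2, of m] by (intro ennreal_leI) simp
  also have "\<dots> = (\<integral>\<^sup>+\<omega>. ennreal ((\<phi> (U \<omega> + V \<omega>) - m)\<^sup>2) \<partial>M)"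
    by (intro nn_integral_eq_integral[symmetric] i5) simp
  also have "\<dots> = (\<integral>\<^sup>+\<omega>. (\<integral>\<^sup>+\<omega>'. ennreal ((\<phi> (U \<omega> + V \<omega>') - m)\<^sup>2) \<partial>M) \<partial>M)"
    using nn_integral_indep_var[OF iUV, of "\<lambda>(u, v). ennreal ((\<phi> (u + v) - m)\<^sup>2)"] by simp
  also have "\<dots> \<le> (\<integral>\<^sup>+\<omega>. ennreal (expectation (\<lambda>\<omega>. (norm (V \<omega>))\<^sup>2) + (\<psi> (U \<omega>) - m)\<^sup>2) \<partial>M)"
    by (intro nn_integral_mono) (auto simp: nn_integral_eq_integral[OF i4] simp del: ennreal_plus intro!: ennreal_leI inner)
  also have "\<dots> = ennreal (expectation (\<lambda>\<omega>. (norm (V \<omega>))\<^sup>2) + variance (\<lambda>\<omega>. \<psi> (U \<omega>)))"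
    using i3 by (subst nn_integral_eq_integral) (auto simp: m_def prob_space)
  also have "\<dots> \<le> ennreal (expectation (\<lambda>\<omega>. (norm (V \<omega>))\<^sup>2) + (\<Sum>i\<in>A. expectation (\<lambda>\<omega>. (norm (Z i \<omega>))\<^sup>2)))"
    using insert.IH[OF _ \<psi>lip] insert.prems by (intro ennreal_leI add_left_mono) (auto simp: U_def)
  finally have "variance (\<lambda>\<omega>. \<phi> (U \<omega> + V \<omega>))
      \<le> expectation (\<lambda>\<omega>. (norm (V \<omega>))\<^sup>2) + (\<Sum>i\<in>A. expectation (\<lambda>\<omega>. (norm (Z i \<omega>))\<^sup>2))"
    by (subst (asm) ennreal_le_iff) (auto intro!: add_nonneg_nonneg sum_nonneg)
  then show ?case
    using insert.hyps by (simp add: U_def V_def add.commute)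
qed

text \<open>Jensen's inequality conditionally on \<open>U\<close>: the value of \<open>U\<close> is
  the mean of \<open>U + V\<close> when only \<open>V\<close> is averaged.\<close>

lemma (in prob_space) expectation_norm_le_add_centered:
  fixes U V :: "'a \<Rightarrow> 'b::{banach, second_countable_topology}"
  assumes "indep_var borel U borel V" "integrable M U" "integrable M V" "expectation V = 0"
  shows "expectation (\<lambda>\<omega>. norm (U \<omega>)) \<le> expectation (\<lambda>\<omega>. norm (U \<omega> + V \<omega>))"
proof -
  have [measurable]: "U \<in> borel_measurable M" "V \<in> borel_measurable M"
    using assms by auto
  have "ennreal (expectation (\<lambda>\<omega>. norm (U \<omega>))) = (\<integral>\<^sup>+\<omega>. norm (U \<omega>) \<partial>M)"
    using assms by (intro nn_integral_eq_integral[symmetric]) auto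
  also have "\<dots> \<le> (\<integral>\<^sup>+\<omega>. (\<integral>\<^sup>+\<omega>'. norm (U \<omega> + V \<omega>') \<partial>M) \<partial>M)"
  proof (rule nn_integral_mono)
    fix \<omega>
    have "U \<omega> = expectation (\<lambda>\<omega>'. U \<omega> + V \<omega>')"
      using assms by (simp add: prob_space)
    then show "ennreal (norm (U \<omega>)) \<le> (\<integral>\<^sup>+\<omega>'. norm (U \<omega> + V \<omega>') \<partial>M)"
      using integral_norm_bound_ennreal[of M "\<lambda>\<omega>'. U \<omega> + V \<omega>'"] assms by simp
  qed
  also have "\<dots> = (\<integral>\<^sup>+\<omega>. norm (U \<omega> + V \<omega>) \<partial>M)"
    using nn_integral_indep_var[OF assms(1), of "\<lambda>(u, v). ennreal (norm (u + v))"] by simp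
  also have "\<dots> = ennreal (expectation (\<lambda>\<omega>. norm (U \<omega> + V \<omega>)))"
    using assms by (intro nn_integral_eq_integral) auto
  finally show ?thesis
    by (subst (asm) ennreal_le_iff) auto
qed

section \<open>Centered sums under Rademacher type\<close>

lemma rademacher_sequence_measurable:
  assumes "rademacher_sequence N R" "i \<ge> 1"
  shows "R i \<in> borel_measurable N"
proof -
  interpret prob_space N using assms by (simp add: rademacher_sequence_def)
  show ?thesis using assms by (auto simp: rademacher_sequence_def indep_vars_def)
qed

lemma rademacher_sequence_AE:
  assumes R: "rademacher_sequence N R" "i \<ge> 1"
  shows "AE w in N. R i w \<in> {-1, 1}"
proof -
  interpret prob_space N using R by (simp add: rademacher_sequence_def)
  note [measurable] = rademacher_sequence_measurable[OF R]
  have "prob ({w \<in> space N. R i w = 1} \<union> {w \<in> space N. R i w = -1})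
      = prob {w \<in> space N. R i w = 1} + prob {w \<in> space N. R i w = -1}"
    by (intro finite_measure_Union) auto
  also have "\<dots> = 1"
    using R unfolding rademacher_sequence_def by (metis field_sum_of_halves)
  finally have "AE w in N. w \<in> {w \<in> space N. R i w = 1} \<union> {w \<in> space N. R i w = -1}"
    by (subst (asm) prob_eq_1) auto
  then show ?thesis by eventually_elim auto
qed

text \<open>Padding the vectors with zeros makes the partial sums eventually constant, so the padded
  series converges in probability and its type inequality becomes one for finite sums.\<close>

lemma rademacher_type_finite:
  fixes R :: "nat \<Rightarrow> 'w \<Rightarrow> real"
  assumes R: "rademacher_sequence N R"
    and "rademacher_type N R TYPE('b::{banach, second_countable_topology}) p"
  obtains C where "0 < C"
    "\<And>n (v :: nat \<Rightarrow> 'b). (\<integral>\<^sup>+w. ennreal (norm (\<Sum>i=1..n. R i w *\<^sub>R v i) powr p) \<partial>N)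
      \<le> ennreal (C * (\<Sum>i=1..n. norm (v i) powr p))"
proof -
  interpret N: prob_space N using R by (simp add: rademacher_sequence_def)
  note [measurable] = rademacher_sequence_measurable[OF R]
  obtain C where "0 < C" and C: "\<And>v S. rademacher_sum N R v (S :: 'w \<Rightarrow> 'b) \<Longrightarrow>
      (\<integral>\<^sup>+w. ennreal (norm (S w) powr p) \<partial>N)
        \<le> ennreal C * (\<Sum>n. ennreal (norm (v (Suc n)) powr p))"
    using assms(2) unfolding rademacher_type_def rademacher_convergent_def by blast
  show thesis
  proof (rule that[OF \<open>0 < C\<close>])
    fix n and v :: "nat \<Rightarrow> 'b"
    define u where "u i = (if i \<le> n then v i else 0)" for i
    let ?S = "\<lambda>w. \<Sum>i=1..n. R i w *\<^sub>R v i"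
    have meas: "(\<lambda>w. \<Sum>i=1..m. R i w *\<^sub>R v' i) \<in> borel_measurable N" for m and v' :: "nat \<Rightarrow> 'b"
      by simp
    have eq: "(\<Sum>i=1..m. R i w *\<^sub>R u i) = ?S w" if "m \<ge> n" for m w
      using that by (intro sum.mono_neutral_cong_right) (auto simp: u_def)
    have "rademacher_sum N R u ?S"
      unfolding rademacher_sum_def tendsto_in_prob_def
    proof (intro conjI allI impI meas)
      fix \<epsilon> :: real assume "\<epsilon> > 0"
      have "eventually (\<lambda>m. measure N {w \<in> space N. norm ((\<Sum>i=1..m. R i w *\<^sub>R u i) - ?S w) > \<epsilon>} = 0) sequentially"
        using eventually_ge_at_top[of n]
      proof eventually_elim
        case (elim m)
        show ?case using \<open>\<epsilon> > 0\<close> by (simp only: eq[OF elim]) simp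
      qed
      then show "(\<lambda>m. measure N {w \<in> space N. norm ((\<Sum>i=1..m. R i w *\<^sub>R u i) - ?S w) > \<epsilon>}) \<longlonglongrightarrow> 0"
        by (rule tendsto_eventually)
    qed
    from C[OF this] have "(\<integral>\<^sup>+w. ennreal (norm (?S w) powr p) \<partial>N)
        \<le> ennreal C * (\<Sum>k. ennreal (norm (u (Suc k)) powr p))" .
    also have "(\<Sum>k. ennreal (norm (u (Suc k)) powr p)) = (\<Sum>k<n. ennreal (norm (u (Suc k)) powr p))"
      by (rule suminf_finite) (auto simp: u_def)
    also have "\<dots> = ennreal (\<Sum>k<n. norm (v (Suc k)) powr p)"
      by (simp add: u_def)
    also have "(\<Sum>k<n. norm (v (Suc k)) powr p) = (\<Sum>i=1..n. norm (v i) powr p)"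
      by (rule sum.reindex_bij_witness[of _ "\<lambda>i. i - 1" Suc]) auto
    also have "ennreal C * ennreal (\<Sum>i=1..n. norm (v i) powr p) = ennreal (C * (\<Sum>i=1..n. norm (v i) powr p))"
      using \<open>0 < C\<close> by (intro ennreal_mult[symmetric]) (auto intro: sum_nonneg)
    finally show "(\<integral>\<^sup>+w. ennreal (norm (?S w) powr p) \<partial>N) \<le> ennreal (C * (\<Sum>i=1..n. norm (v i) powr p))" .
  qed
qed

text \<open>The indices split by sign into two halves. Each half sum is, up to sign, the signed sum
  with an independent centered part removed, and such a removal cannot increase the expected norm;
  the two halves give the factor 2.\<close>

lemma (in prob_space) expectation_norm_sum_le_signed:
  fixes Z :: "'i \<Rightarrow> 'a \<Rightarrow> 'b::{banach, second_countable_topology}"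
  assumes indep: "indep_vars (\<lambda>_. borel) Z I" and "finite I"
    and int: "\<And>i. i \<in> I \<Longrightarrow> integrable M (Z i)"
    and zero: "\<And>i. i \<in> I \<Longrightarrow> expectation (Z i) = 0"
    and e: "\<And>i. i \<in> I \<Longrightarrow> e i \<in> {-1, 1}"
  shows "expectation (\<lambda>\<omega>. norm (\<Sum>i\<in>I. Z i \<omega>))
    \<le> 2 * expectation (\<lambda>\<omega>. norm (\<Sum>i\<in>I. e i *\<^sub>R Z i \<omega>))"
proof -
  let ?S = "\<lambda>\<omega>. \<Sum>i\<in>I. e i *\<^sub>R Z i \<omega>"
  have part: "expectation (\<lambda>\<omega>. norm (\<Sum>i\<in>A. Z i \<omega>)) \<le> expectation (\<lambda>\<omega>. norm (?S \<omega>))"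
    if A: "A \<subseteq> I" "c \<in> {-1, 1}" "\<And>i. i \<in> A \<Longrightarrow> e i = c" "\<And>i. i \<in> I - A \<Longrightarrow> e i = - c" for A c
  proof -
    have "indep_var borel (\<lambda>\<omega>. \<Sum>i\<in>A. Z i \<omega>) borel (\<lambda>\<omega>. \<Sum>i\<in>I-A. Z i \<omega>)"
      using A by (intro indep_var_sums[OF indep]) auto
    then have iv: "indep_var borel (\<lambda>\<omega>. \<Sum>i\<in>A. Z i \<omega>) borel (\<lambda>\<omega>. - (\<Sum>i\<in>I-A. Z i \<omega>))"
      by (rule indep_var_compose[unfolded comp_def, of _ _ _ _ "\<lambda>x. x" _ uminus]) auto
    have "expectation (\<lambda>\<omega>. norm (\<Sum>i\<in>A. Z i \<omega>))
        \<le> expectation (\<lambda>\<omega>. norm ((\<Sum>i\<in>A. Z i \<omega>) + (- (\<Sum>i\<in>I-A. Z i \<omega>))))"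
      using A(1) int zero
      by (intro expectation_norm_le_add_centered iv Bochner_Integration.integrable_minus
            Bochner_Integration.integrable_sum) (auto simp: subset_iff)
    also have "(\<lambda>\<omega>. norm ((\<Sum>i\<in>A. Z i \<omega>) + (- (\<Sum>i\<in>I-A. Z i \<omega>)))) = (\<lambda>\<omega>. norm (?S \<omega>))"
    proof
      fix \<omega>
      have "?S \<omega> = (\<Sum>i\<in>A. e i *\<^sub>R Z i \<omega>) + (\<Sum>i\<in>I-A. e i *\<^sub>R Z i \<omega>)"
        using A(1) \<open>finite I\<close> by (metis sum.subset_diff add.commute)
      also have "\<dots> = c *\<^sub>R ((\<Sum>i\<in>A. Z i \<omega>) + (- (\<Sum>i\<in>I-A. Z i \<omega>)))"
        using A(3,4) by (simp add: scaleR_right_diff_distrib scaleR_right.sum sum_negf)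
      finally show "norm ((\<Sum>i\<in>A. Z i \<omega>) + (- (\<Sum>i\<in>I-A. Z i \<omega>))) = norm (?S \<omega>)"
        using A(2) by auto
    qed
    finally show ?thesis .
  qed
  have intB: "integrable M (\<lambda>\<omega>. \<Sum>i\<in>B. Z i \<omega>)" if "B \<subseteq> I" for B
    using that int by (intro Bochner_Integration.integrable_sum) auto
  define A where "A = {i\<in>I. e i = 1}"
  have A: "A \<subseteq> I" "\<And>i. i \<in> A \<Longrightarrow> e i = 1" "\<And>i. i \<in> I - A \<Longrightarrow> e i = -1"
    using e by (auto simp: A_def)
  have "expectation (\<lambda>\<omega>. norm (\<Sum>i\<in>I. Z i \<omega>))
      \<le> expectation (\<lambda>\<omega>. norm (\<Sum>i\<in>A. Z i \<omega>) + norm (\<Sum>i\<in>I-A. Z i \<omega>))"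
  proof (rule integral_mono)
    show "norm (\<Sum>i\<in>I. Z i \<omega>) \<le> norm (\<Sum>i\<in>A. Z i \<omega>) + norm (\<Sum>i\<in>I-A. Z i \<omega>)" for \<omega>
      using sum.subset_diff[OF A(1) \<open>finite I\<close>, of "\<lambda>i. Z i \<omega>"] by (metis norm_triangle_ineq add.commute)
  qed (intro Bochner_Integration.integrable_add integrable_norm intB; use A(1) in auto)+
  also have "\<dots> = expectation (\<lambda>\<omega>. norm (\<Sum>i\<in>A. Z i \<omega>)) + expectation (\<lambda>\<omega>. norm (\<Sum>i\<in>I-A. Z i \<omega>))"
    using A(1) by (intro Bochner_Integration.integral_add integrable_norm intB) auto
  also have "\<dots> \<le> expectation (\<lambda>\<omega>. norm (?S \<omega>)) + expectation (\<lambda>\<omega>. norm (?S \<omega>))"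
    using A by (intro add_mono part[of A 1] part[of "I - A" "-1"]) auto
  finally show ?thesis by simp
qed

text \<open>Centering subtracts from the signed sum its mean, whose norm is at most the expected
  norm.\<close>

lemma (in prob_space) expectation_norm_signed_centered_le:
  fixes Z :: "'i \<Rightarrow> 'a \<Rightarrow> 'b::{banach, second_countable_topology}"
  assumes int: "\<And>i. i \<in> I \<Longrightarrow> integrable M (Z i)"
  shows "expectation (\<lambda>\<omega>. norm (\<Sum>i\<in>I. e i *\<^sub>R (Z i \<omega> - expectation (Z i))))
    \<le> 2 * expectation (\<lambda>\<omega>. norm (\<Sum>i\<in>I. e i *\<^sub>R Z i \<omega>))"
proof -
  let ?S = "\<lambda>\<omega>. \<Sum>i\<in>I. e i *\<^sub>R Z i \<omega>"
  have S: "integrable M ?S" using int by auto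
  have "expectation ?S = (\<Sum>i\<in>I. e i *\<^sub>R expectation (Z i))"
    using int by (subst Bochner_Integration.integral_sum) auto
  then have "(\<lambda>\<omega>. norm (\<Sum>i\<in>I. e i *\<^sub>R (Z i \<omega> - expectation (Z i)))) = (\<lambda>\<omega>. norm (?S \<omega> - expectation ?S))"
    by (simp add: scaleR_diff_right sum_subtractf)
  then have "expectation (\<lambda>\<omega>. norm (\<Sum>i\<in>I. e i *\<^sub>R (Z i \<omega> - expectation (Z i))))
      = expectation (\<lambda>\<omega>. norm (?S \<omega> - expectation ?S))"
    by simp
  also have "\<dots> \<le> expectation (\<lambda>\<omega>. norm (?S \<omega>) + norm (expectation ?S))"
    using S by (intro integral_mono norm_triangle_ineq4) auto
  also have "\<dots> = expectation (\<lambda>\<omega>. norm (?S \<omega>)) + norm (expectation ?S)"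
    using S by (simp add: prob_space)
  also have "\<dots> \<le> 2 * expectation (\<lambda>\<omega>. norm (?S \<omega>))"
    using integral_norm_bound[of M ?S] by simp
  finally show ?thesis .
qed

text \<open>For \<open>a > c\<close> the factor \<open>a powr (1 - p)\<close> is at most
  \<open>c powr (1 - p)\<close>, the exponent being nonpositive. This converts a bound on a p-th
  moment into one on a first moment.\<close>

lemma le_add_powr:
  fixes a c p :: real
  assumes "0 \<le> a" "0 < c" "1 \<le> p"
  shows "a \<le> c + c powr (1 - p) * a powr p"
proof (cases "a \<le> c")
  case False
  then have "a = a powr (1 - p) * a powr p"
    using assms by (simp add: powr_add[symmetric])
  also have "\<dots> \<le> c powr (1 - p) * a powr p"
    using False assms by (intro mult_right_mono powr_mono2') auto
  finally show ?thesis using assms by simp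
qed (use assms in \<open>simp add: add_increasing2\<close>)

text \<open>The free parameter \<open>c\<close> replaces Jensen's inequality for the power \<open>p\<close>.\<close>

lemma (in prob_space) expectation_norm_centered_sum_le:
  fixes Z :: "nat \<Rightarrow> 'a \<Rightarrow> 'b::{banach, second_countable_topology}"
  assumes R: "rademacher_sequence N R"
    and C: "0 < C" "\<And>v :: nat \<Rightarrow> 'b. (\<integral>\<^sup>+w. ennreal (norm (\<Sum>i=1..n. R i w *\<^sub>R v i) powr p) \<partial>N)
      \<le> ennreal (C * (\<Sum>i=1..n. norm (v i) powr p))"
    and "1 \<le> p" "0 < c"
    and indep: "indep_vars (\<lambda>_. borel) Z {1..n}"
    and bdd: "\<And>i \<omega>. i \<in> {1..n} \<Longrightarrow> norm (Z i \<omega>) \<le> K"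
  shows "expectation (\<lambda>\<omega>. norm (\<Sum>i=1..n. Z i \<omega> - expectation (Z i)))
    \<le> 4 * (c + c powr (1 - p) * (C * (\<Sum>i=1..n. expectation (\<lambda>\<omega>. norm (Z i \<omega>) powr p))))"
proof -
  interpret N: prob_space N using R by (simp add: rademacher_sequence_def)
  interpret MN: pair_sigma_finite N M ..
  \<comment> \<open>Extension by 0 makes the variables measurable at every index, as wanted for the
    joint integrand of the Tonelli exchange, and leaves the sums unchanged.\<close>
  define r where "r i = (if i \<ge> 1 then R i else (\<lambda>_. 0))" for i
  define z where "z i = (if i \<in> {1..n} then Z i else (\<lambda>_. 0))" for i
  have [measurable]: "r i \<in> borel_measurable N" for i
    using rademacher_sequence_measurable[OF R] by (simp add: r_def)
  have [measurable]: "Z i \<in> borel_measurable M" if "i \<in> {1..n}" for i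
    using indep that by (auto simp: indep_vars_def)
  have [measurable]: "z i \<in> borel_measurable M" for i
    by (simp add: z_def)
  have int: "integrable M (Z i)" if "i \<in> {1..n}" for i
    using that bdd by (intro integrable_bounded[of _ K]) auto
  have rz: "(\<Sum>i=1..n. R i w *\<^sub>R Z i \<omega>) = (\<Sum>i=1..n. r i w *\<^sub>R z i \<omega>)" for w \<omega>
    by (rule sum.cong) (auto simp: r_def z_def)
  let ?E = "expectation (\<lambda>\<omega>. norm (\<Sum>i=1..n. Z i \<omega> - expectation (Z i)))"
  have "AE w in N. \<forall>i\<in>{1..n}. R i w \<in> {-1, 1}"
    by (intro AE_finite_allI) (auto intro: rademacher_sequence_AE[OF R, simplified])
  \<comment> \<open>For almost every fixed \<open>w\<close> the signs are inserted at the cost of a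
    factor 2 and the centering is removed at the cost of another 2, whence the constant 4.\<close>
  then have sgn: "AE w in N. ennreal ?E \<le> 4 * (\<integral>\<^sup>+\<omega>. ennreal (norm (\<Sum>i=1..n. r i w *\<^sub>R z i \<omega>)) \<partial>M)"
  proof eventually_elim
    case (elim w)
    have "?E \<le> 2 * expectation (\<lambda>\<omega>. norm (\<Sum>i=1..n. R i w *\<^sub>R (Z i \<omega> - expectation (Z i))))"
    proof (rule expectation_norm_sum_le_signed)
      show "indep_vars (\<lambda>_. borel) (\<lambda>i \<omega>. Z i \<omega> - expectation (Z i)) {1..n}"
        by (rule indep_vars_compose2[OF indep, of "\<lambda>i x. x - expectation (Z i)"]) auto
    qed (use int elim in \<open>auto simp: prob_space\<close>)
    also have "\<dots> \<le> 2 * (2 * expectation (\<lambda>\<omega>. norm (\<Sum>i=1..n. R i w *\<^sub>R Z i \<omega>)))"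
      using int by (intro mult_left_mono expectation_norm_signed_centered_le) auto
    finally have "ennreal ?E \<le> ennreal (4 * expectation (\<lambda>\<omega>. norm (\<Sum>i=1..n. R i w *\<^sub>R Z i \<omega>)))"
      by (intro ennreal_leI) simp
    also have "\<dots> = 4 * ennreal (expectation (\<lambda>\<omega>. norm (\<Sum>i=1..n. R i w *\<^sub>R Z i \<omega>)))"
      by (simp add: ennreal_mult)
    also have "ennreal (expectation (\<lambda>\<omega>. norm (\<Sum>i=1..n. R i w *\<^sub>R Z i \<omega>)))
        = (\<integral>\<^sup>+\<omega>. ennreal (norm (\<Sum>i=1..n. R i w *\<^sub>R Z i \<omega>)) \<partial>M)"
      using int
      by (intro nn_integral_eq_integral[symmetric] integrable_norm Bochner_Integration.integrable_sum) auto
    finally show ?case unfolding rz .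
  qed
  have intp: "integrable M (\<lambda>\<omega>. norm (Z i \<omega>) powr p)" if "i \<in> {1..n}" for i
    using that bdd \<open>1 \<le> p\<close> by (intro integrable_bounded[of _ "K powr p"]) (auto intro!: powr_mono2)
  have intS: "integrable M (\<lambda>\<omega>. \<Sum>i=1..n. norm (Z i \<omega>) powr p)"
    using intp by (intro Bochner_Integration.integrable_sum)
  have "ennreal ?E = (\<integral>\<^sup>+w. ennreal ?E \<partial>N)"
    by (simp add: N.emeasure_space_1)
  also have "\<dots> \<le> (\<integral>\<^sup>+w. 4 * (\<integral>\<^sup>+\<omega>. ennreal (norm (\<Sum>i=1..n. r i w *\<^sub>R z i \<omega>)) \<partial>M) \<partial>N)"
    by (rule nn_integral_mono_AE[OF sgn])
  \<comment> \<open>After the exchange \<open>\<omega>\<close> is fixed, so the type inequality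
    applies to the deterministic vectors \<open>Z i \<omega>\<close>.\<close>
  also have "\<dots> = 4 * (\<integral>\<^sup>+\<omega>. (\<integral>\<^sup>+w. ennreal (norm (\<Sum>i=1..n. r i w *\<^sub>R z i \<omega>)) \<partial>N) \<partial>M)"
    by (subst MN.Fubini') (auto simp: nn_integral_cmult)
  also have "\<dots> \<le> 4 * (\<integral>\<^sup>+\<omega>. ennreal (c + c powr (1 - p) * (C * (\<Sum>i=1..n. norm (Z i \<omega>) powr p))) \<partial>M)"
  proof (intro mult_left_mono nn_integral_mono)
    fix \<omega>
    have "(\<integral>\<^sup>+w. ennreal (norm (\<Sum>i=1..n. r i w *\<^sub>R z i \<omega>)) \<partial>N)
        \<le> (\<integral>\<^sup>+w. ennreal c + ennreal (c powr (1 - p)) * ennreal (norm (\<Sum>i=1..n. r i w *\<^sub>R z i \<omega>) powr p) \<partial>N)"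
      using \<open>0 < c\<close> le_add_powr[OF norm_ge_zero \<open>0 < c\<close> \<open>1 \<le> p\<close>]
      by (intro nn_integral_mono)
        (auto simp: ennreal_mult[symmetric] ennreal_plus[symmetric] simp del: ennreal_plus intro!: ennreal_leI)
    also have "\<dots> = ennreal c + ennreal (c powr (1 - p)) * (\<integral>\<^sup>+w. ennreal (norm (\<Sum>i=1..n. R i w *\<^sub>R Z i \<omega>) powr p) \<partial>N)"
      unfolding rz by (subst nn_integral_add) (auto simp: nn_integral_cmult N.emeasure_space_1)
    also have "\<dots> \<le> ennreal c + ennreal (c powr (1 - p)) * ennreal (C * (\<Sum>i=1..n. norm (Z i \<omega>) powr p))"
      by (intro add_left_mono mult_left_mono C(2)) auto
    also have "\<dots> = ennreal (c + c powr (1 - p) * (C * (\<Sum>i=1..n. norm (Z i \<omega>) powr p)))"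
      using \<open>0 < c\<close> \<open>0 < C\<close>
      by (simp add: ennreal_mult[symmetric] sum_nonneg ennreal_plus[symmetric] del: ennreal_plus)
    finally show "(\<integral>\<^sup>+w. ennreal (norm (\<Sum>i=1..n. r i w *\<^sub>R z i \<omega>)) \<partial>N) \<le> \<dots>" .
  qed simp
  also have "\<dots> = 4 * ennreal (expectation (\<lambda>\<omega>. c + c powr (1 - p) * (C * (\<Sum>i=1..n. norm (Z i \<omega>) powr p))))"
    using intS \<open>0 < c\<close> \<open>0 < C\<close>
    by (subst nn_integral_eq_integral) (auto simp del: Bochner_Integration.integrable_sum intro!: AE_I2 add_nonneg_nonneg mult_nonneg_nonneg sum_nonneg)
  also have "expectation (\<lambda>\<omega>. c + c powr (1 - p) * (C * (\<Sum>i=1..n. norm (Z i \<omega>) powr p)))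
      = c + c powr (1 - p) * (C * (\<Sum>i=1..n. expectation (\<lambda>\<omega>. norm (Z i \<omega>) powr p)))"
    using intS intp by (subst Bochner_Integration.integral_add)
      (auto simp: prob_space Bochner_Integration.integral_sum simp del: Bochner_Integration.integrable_sum)
  also have "4 * ennreal \<dots> = ennreal (4 * \<dots>)"
    by (subst ennreal_mult') (simp, simp only: ennreal_numeral)
  finally show ?thesis
    using \<open>0 < c\<close> \<open>0 < C\<close>
    by (subst (asm) ennreal_le_iff) (auto intro!: add_nonneg_nonneg mult_nonneg_nonneg sum_nonneg)
qed

text \<open>Grouping the summands by value turns the centered sum into a combination of the vectors
  in \<open>V\<close> whose coefficients are centered counts. Each count has variance at most
  \<open>n\<close>, hence mean absolute deviation of order \<open>sqrt n\<close>.\<close>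

lemma (in prob_space) expectation_norm_finite_range_sum_le:
  fixes Z :: "nat \<Rightarrow> 'a \<Rightarrow> 'b::{banach, second_countable_topology}"
  assumes indep: "indep_vars (\<lambda>_. borel) Z {1..n}" and "finite V"
    and V: "\<And>i \<omega>. i \<in> {1..n} \<Longrightarrow> Z i \<omega> \<in> V"
  shows "expectation (\<lambda>\<omega>. norm (\<Sum>i=1..n. Z i \<omega> - expectation (Z i)))
    \<le> 2 * sqrt (real n) * (\<Sum>v\<in>V. norm v)"
proof (cases "n = 0")
  case False
  have [measurable]: "Z i \<in> borel_measurable M" if "i \<in> {1..n}" for i
    using indep that by (auto simp: indep_vars_def)
  define f where "f v i \<omega> = (indicator {v} (Z i \<omega>) :: real)" for v i \<omega>
  have f[measurable]: "f v i \<in> borel_measurable M" if "i \<in> {1..n}" for v i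
    unfolding f_def using that by measurable
  have f01: "0 \<le> f v i \<omega>" "f v i \<omega> \<le> 1" for v i \<omega>
    by (auto simp: f_def)
  have intf: "integrable M (f v i)" if "i \<in> {1..n}" for v i
    using f01 that by (intro integrable_bounded[of _ 1]) auto
  define W where "W v \<omega> = (\<Sum>i=1..n. f v i \<omega>)" for v \<omega>
  have W[measurable]: "W v \<in> borel_measurable M" for v
    unfolding W_def using f by simp
  have Wbd: "\<bar>W v \<omega>\<bar> \<le> real n" for v \<omega>
    unfolding W_def using sum_bounded_above[of "{1..n}" "\<lambda>i. f v i \<omega>" 1] f01
    by (simp add: sum_nonneg)
  have intW: "integrable M (W v)" for v
    using Wbd by (intro integrable_bounded[of _ "real n"]) auto
  have intW2: "integrable M (\<lambda>\<omega>. (W v \<omega> - a)\<^sup>2)" for v a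
  proof -
    have "\<bar>W v \<omega> - a\<bar> \<le> \<bar>real n + \<bar>a\<bar>\<bar>" for \<omega> using Wbd[of v \<omega>] by linarith
    then show ?thesis
      by (intro integrable_bounded[of _ "(real n + \<bar>a\<bar>)\<^sup>2"]) (auto simp: abs_le_square_iff[symmetric])
  qed
  have EW: "expectation (\<lambda>\<omega>. \<bar>W v \<omega> - expectation (W v)\<bar>) \<le> 2 * sqrt (real n)" for v
  proof -
    have "variance (W v) \<le> (\<Sum>i=1..n. expectation (\<lambda>\<omega>. (norm (f v i \<omega>))\<^sup>2))"
      unfolding W_def
    proof (rule variance_lipschitz_sum[where I = "{1..n}" and K = 1])
      show "indep_vars (\<lambda>_. borel) (\<lambda>i \<omega>. f v i \<omega>) {1..n}"
        unfolding f_def by (rule indep_vars_compose2[OF indep]) auto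
    qed (use f01 in \<open>auto intro: lipschitz_onI\<close>)
    also have "\<dots> \<le> (\<Sum>i=1..n. 1)"
    proof (rule sum_mono)
      fix i assume i: "i \<in> {1..n}"
      have "(norm (f v i \<omega>))\<^sup>2 \<le> 1" for \<omega>
        using f01[of v i \<omega>] by (simp add: power_le_one)
      then have "expectation (\<lambda>\<omega>. (norm (f v i \<omega>))\<^sup>2) \<le> expectation (\<lambda>_. 1)"
        using i by (intro integral_mono integrable_bounded[of _ 1]) auto
      then show "expectation (\<lambda>\<omega>. (norm (f v i \<omega>))\<^sup>2) \<le> 1"
        by (simp add: prob_space)
    qed
    finally have var: "variance (W v) \<le> real n" by simp
    \<comment> \<open>An elementary substitute for the Cauchy-Schwarz inequality, weighted so that
      both terms have order \<open>sqrt n\<close> once the variance is at most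
      \<open>n\<close>.\<close>
    have le: "\<bar>w\<bar> \<le> sqrt (real n) + w\<^sup>2 / sqrt (real n)" for w :: real
    proof (cases "\<bar>w\<bar> \<le> sqrt (real n)")
      case False
      then have "\<bar>w\<bar> * sqrt (real n) \<le> \<bar>w\<bar> * \<bar>w\<bar>"
        by (intro mult_left_mono) auto
      then have "\<bar>w\<bar> * sqrt (real n) \<le> w\<^sup>2"
        by (simp add: power2_eq_square)
      then show ?thesis using \<open>n \<noteq> 0\<close> by (simp add: field_simps)
    qed (simp add: add_increasing2)
    have "expectation (\<lambda>\<omega>. \<bar>W v \<omega> - expectation (W v)\<bar>)
        \<le> expectation (\<lambda>\<omega>. sqrt (real n) + (W v \<omega> - expectation (W v))\<^sup>2 / sqrt (real n))"
      using intW intW2 by (intro integral_mono le) auto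
    also have "\<dots> = sqrt (real n) + variance (W v) / sqrt (real n)"
      using intW2 by (subst Bochner_Integration.integral_add) (auto simp: prob_space)
    also have "\<dots> \<le> sqrt (real n) + real n / sqrt (real n)"
      by (intro add_left_mono divide_right_mono var) simp
    also have "\<dots> = 2 * sqrt (real n)"
      by (simp add: real_div_sqrt)
    finally show ?thesis .
  qed
  have Z: "Z i \<omega> = (\<Sum>v\<in>V. f v i \<omega> *\<^sub>R v)" if "i \<in> {1..n}" for i \<omega>
    using sum.mono_neutral_right[of V "{Z i \<omega>}" "\<lambda>v. f v i \<omega> *\<^sub>R v"] V[OF that, of \<omega>] \<open>finite V\<close>
    by (simp add: f_def indicator_def)
  have EZ: "expectation (Z i) = (\<Sum>v\<in>V. expectation (f v i) *\<^sub>R v)" if "i \<in> {1..n}" for i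
  proof -
    have "expectation (Z i) = expectation (\<lambda>\<omega>. \<Sum>v\<in>V. f v i \<omega> *\<^sub>R v)"
      using Z[OF that] by (simp cong: Bochner_Integration.integral_cong)
    then show ?thesis
      using intf[OF that] by (simp add: Bochner_Integration.integral_sum)
  qed
  have "(\<Sum>i=1..n. Z i \<omega> - expectation (Z i)) = (\<Sum>v\<in>V. (W v \<omega> - expectation (W v)) *\<^sub>R v)" for \<omega>
  proof -
    have "(\<Sum>i=1..n. Z i \<omega> - expectation (Z i))
        = (\<Sum>i=1..n. \<Sum>v\<in>V. (f v i \<omega> - expectation (f v i)) *\<^sub>R v)"
      by (intro sum.cong refl) (simp only: Z EZ sum_subtractf[symmetric] scaleR_diff_left)
    also have "\<dots> = (\<Sum>v\<in>V. \<Sum>i=1..n. (f v i \<omega> - expectation (f v i)) *\<^sub>R v)"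
      by (rule sum.swap)
    also have "\<dots> = (\<Sum>v\<in>V. (W v \<omega> - expectation (W v)) *\<^sub>R v)"
    proof (rule sum.cong[OF refl])
      fix v
      have "expectation (W v) = (\<Sum>i=1..n. expectation (f v i))"
        unfolding W_def using intf by (subst Bochner_Integration.integral_sum) auto
      then show "(\<Sum>i=1..n. (f v i \<omega> - expectation (f v i)) *\<^sub>R v) = (W v \<omega> - expectation (W v)) *\<^sub>R v"
        by (simp add: W_def scaleR_left.sum[symmetric] sum_subtractf)
    qed
    finally show ?thesis .
  qed
  then have "expectation (\<lambda>\<omega>. norm (\<Sum>i=1..n. Z i \<omega> - expectation (Z i)))
      = expectation (\<lambda>\<omega>. norm (\<Sum>v\<in>V. (W v \<omega> - expectation (W v)) *\<^sub>R v))"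
    by simp
  also have "\<dots> \<le> expectation (\<lambda>\<omega>. \<Sum>v\<in>V. \<bar>W v \<omega> - expectation (W v)\<bar> * norm v)"
  proof (rule integral_mono)
    show "norm (\<Sum>v\<in>V. (W v \<omega> - expectation (W v)) *\<^sub>R v) \<le> (\<Sum>v\<in>V. \<bar>W v \<omega> - expectation (W v)\<bar> * norm v)" for \<omega>
      by (rule order_trans[OF norm_sum]) simp
  qed (use intW in auto)
  also have "\<dots> = (\<Sum>v\<in>V. expectation (\<lambda>\<omega>. \<bar>W v \<omega> - expectation (W v)\<bar>) * norm v)"
    using intW by (subst Bochner_Integration.integral_sum) auto
  also have "\<dots> \<le> (\<Sum>v\<in>V. (2 * sqrt (real n)) * norm v)"
    by (intro sum_mono mult_right_mono EW) simp
  finally show ?thesis by (simp add: sum_distrib_left)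
qed simp

section \<open>Maximal inequality and second Borel-Cantelli lemma\<close>

text \<open>If some partial sum exceeds \<open>3 * t\<close>, then either the last one exceeds
  \<open>t\<close> or the increment after the first passage exceeds \<open>2 * t\<close>. That
  increment is independent of the passage event and is so large with probability at most
  \<open>2 * q\<close>; the passage events are disjoint, so their probabilities add up to at most
  1.\<close>

lemma (in prob_space) etemadi_inequality:
  fixes Z :: "nat \<Rightarrow> 'a \<Rightarrow> 'b::{second_countable_topology, real_normed_vector}"
  assumes indep: "indep_vars (\<lambda>_. borel) Z {1..n}" and "0 \<le> t"
    and q: "\<And>k. k \<le> n \<Longrightarrow> prob {\<omega>\<in>space M. norm (\<Sum>i=1..k. Z i \<omega>) > t} \<le> q"
  shows "prob {\<omega>\<in>space M. \<exists>k\<le>n. norm (\<Sum>i=1..k. Z i \<omega>) > 3 * t} \<le> 3 * q"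
proof -
  define T where "T k \<omega> = (\<Sum>i=1..k. Z i \<omega>)" for k \<omega>
  have [measurable]: "Z i \<in> borel_measurable M" if "i \<in> {1..n}" for i
    using indep that by (auto simp: indep_vars_def)
  have T[measurable]: "T k \<in> borel_measurable M" if "k \<le> n" for k
    unfolding T_def using that by (intro borel_measurable_sum) auto
  have q0: "0 \<le> q" using q[of 0] measure_nonneg order_trans by blast
  define B where "B k = {\<omega>\<in>space M. norm (T k \<omega>) > 3 * t \<and> (\<forall>j\<in>{..<k}. norm (T j \<omega>) \<le> 3 * t)}" for k
  define D where "D k = {\<omega>\<in>space M. norm (T n \<omega> - T k \<omega>) > 2 * t}" for k
  have B[measurable]: "B k \<in> events" if "k \<le> n" for k
    unfolding B_def using that
    by (intro sets.sets_Collect_conj sets.sets_Collect_finite_All) auto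
  have D[measurable]: "D k \<in> events" if "k \<le> n" for k
    unfolding D_def using that by auto
  have disj: "disjoint_family_on B {..n}"
    unfolding disjoint_family_on_def B_def by (auto simp: not_le[symmetric]) (metis lessThan_iff linorder_neqE_nat)
  \<comment> \<open>\<open>B k\<close> depends on the first \<open>k\<close> variables and
    \<open>D k\<close> on the later ones; both are written as preimages under restrictions to
    disjoint index blocks.\<close>
  have BD: "prob (B k \<inter> D k) = prob (B k) * prob (D k)" if k: "k \<le> n" for k
  proof -
    have iv: "indep_var (PiM {1..k} (\<lambda>_. borel)) (\<lambda>\<omega>. restrict (\<lambda>i. Z i \<omega>) {1..k})
        (PiM {Suc k..n} (\<lambda>_. borel)) (\<lambda>\<omega>. restrict (\<lambda>i. Z i \<omega>) {Suc k..n})"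
      using k by (intro indep_var_restrict[OF indep]) auto
    define B' where "B' = {f\<in>space (PiM {1..k} (\<lambda>_. borel :: 'b measure)). norm (\<Sum>i=1..k. f i) > 3 * t
        \<and> (\<forall>j\<in>{..<k}. norm (\<Sum>i=1..j. f i) \<le> 3 * t)}"
    define D' where "D' = {f\<in>space (PiM {Suc k..n} (\<lambda>_. borel :: 'b measure)). norm (\<Sum>i=Suc k..n. f i) > 2 * t}"
    have sums: "(\<lambda>f. \<Sum>i=1..j. f i) \<in> borel_measurable (PiM {1..k} (\<lambda>_. borel :: 'b measure))" if "j \<le> k" for j
      using that by (intro borel_measurable_sum) auto
    have B'm: "B' \<in> sets (PiM {1..k} (\<lambda>_. borel))"
      unfolding B'_def
      by (intro sets.sets_Collect_conj sets.sets_Collect_finite_All)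
        (use sums in \<open>auto intro!: borel_measurable_le borel_measurable_less\<close>)
    have D'm: "D' \<in> sets (PiM {Suc k..n} (\<lambda>_. borel))"
      unfolding D'_def by measurable
    have Tdiff: "T n \<omega> - T k \<omega> = (\<Sum>i=Suc k..n. Z i \<omega>)" for \<omega>
      using sum.ub_add_nat[of 1 k "\<lambda>i. Z i \<omega>" "n - k"] k by (simp add: T_def)
    have resB: "(\<Sum>i=1..j. restrict (\<lambda>i. Z i \<omega>) {1..k} i) = (\<Sum>i=1..j. Z i \<omega>)" if "j \<le> k" for j \<omega>
      using that by (intro sum.cong) auto
    have rB: "(\<lambda>\<omega>. restrict (\<lambda>i. Z i \<omega>) {1..k}) -` B' \<inter> space M = B k"
      unfolding B_def B'_def T_def
      by (auto simp: space_PiM resB simp del: restrict_apply One_nat_def)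
    have rD: "(\<lambda>\<omega>. restrict (\<lambda>i. Z i \<omega>) {Suc k..n}) -` D' \<inter> space M = D k"
      unfolding D_def D'_def Tdiff by (auto simp: space_PiM)
    have "prob ((\<lambda>\<omega>. (restrict (\<lambda>i. Z i \<omega>) {1..k}, restrict (\<lambda>i. Z i \<omega>) {Suc k..n})) -` (B' \<times> D') \<inter> space M)
        = prob (B k) * prob (D k)"
      using indep_varD[OF iv B'm D'm] by (simp only: rB rD)
    also have "(\<lambda>\<omega>. (restrict (\<lambda>i. Z i \<omega>) {1..k}, restrict (\<lambda>i. Z i \<omega>) {Suc k..n})) -` (B' \<times> D') \<inter> space M = B k \<inter> D k"
      unfolding rB[symmetric] rD[symmetric] by auto
    finally show ?thesis .
  qed
  have Dq: "prob (D k) \<le> 2 * q" if k: "k \<le> n" for k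
  proof -
    have "norm (T n \<omega>) > t \<or> norm (T k \<omega>) > t" if "norm (T n \<omega> - T k \<omega>) > 2 * t" for \<omega>
      using norm_triangle_ineq4[of "T n \<omega>" "T k \<omega>"] that by linarith
    then have "D k \<subseteq> {\<omega>\<in>space M. norm (T n \<omega>) > t} \<union> {\<omega>\<in>space M. norm (T k \<omega>) > t}"
      unfolding D_def by blast
    then have "prob (D k) \<le> prob ({\<omega>\<in>space M. norm (T n \<omega>) > t} \<union> {\<omega>\<in>space M. norm (T k \<omega>) > t})"
      using k by (intro finite_measure_mono) auto
    also have "\<dots> \<le> prob {\<omega>\<in>space M. norm (T n \<omega>) > t} + prob {\<omega>\<in>space M. norm (T k \<omega>) > t}"
      using k by (intro measure_Un_le) auto
    also have "\<dots> \<le> q + q"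
      unfolding T_def using k by (intro add_mono q) auto
    finally show ?thesis by simp
  qed
  have "{\<omega>\<in>space M. \<exists>k\<le>n. norm (T k \<omega>) > 3 * t}
      \<subseteq> {\<omega>\<in>space M. norm (T n \<omega>) > t} \<union> (\<Union>k\<le>n. B k \<inter> D k)"
  proof
    fix \<omega> assume \<omega>: "\<omega> \<in> {\<omega>\<in>space M. \<exists>k\<le>n. norm (T k \<omega>) > 3 * t}"
    define k where "k = (LEAST k. norm (T k \<omega>) > 3 * t)"
    have k: "norm (T k \<omega>) > 3 * t" "k \<le> n"
      using \<omega> unfolding k_def by (auto intro: LeastI Least_le le_trans)
    have "norm (T j \<omega>) \<le> 3 * t" if "j < k" for j
      using not_less_Least[of j "\<lambda>k. norm (T k \<omega>) > 3 * t"] that by (simp add: k_def)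
    then have "\<omega> \<in> B k"
      using \<omega> k(1) by (simp add: B_def)
    moreover have "norm (T n \<omega>) > t \<or> \<omega> \<in> D k"
      using \<omega> k norm_triangle_ineq2[of "T k \<omega>" "T n \<omega>"] by (auto simp: D_def norm_minus_commute)
    ultimately show "\<omega> \<in> {\<omega>\<in>space M. norm (T n \<omega>) > t} \<union> (\<Union>k\<le>n. B k \<inter> D k)"
      using \<omega> k by auto
  qed
  then have "prob {\<omega>\<in>space M. \<exists>k\<le>n. norm (T k \<omega>) > 3 * t}
      \<le> prob ({\<omega>\<in>space M. norm (T n \<omega>) > t} \<union> (\<Union>k\<le>n. B k \<inter> D k))"
    by (intro finite_measure_mono) auto
  also have "\<dots> \<le> prob {\<omega>\<in>space M. norm (T n \<omega>) > t} + prob (\<Union>k\<le>n. B k \<inter> D k)"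
    by (intro measure_Un_le) auto
  also have "prob (\<Union>k\<le>n. B k \<inter> D k) \<le> (\<Sum>k\<le>n. prob (B k \<inter> D k))"
    by (intro finite_measure_subadditive_finite) auto
  also have "\<dots> \<le> (\<Sum>k\<le>n. prob (B k) * (2 * q))"
    by (intro sum_mono) (auto simp: BD intro!: mult_left_mono Dq)
  also have "\<dots> = prob (\<Union>k\<le>n. B k) * (2 * q)"
    using disj by (subst finite_measure_finite_Union) (auto simp: sum_distrib_right)
  also have "\<dots> \<le> 1 * (2 * q)"
    using q0 by (intro mult_right_mono) auto
  finally show ?thesis
    using q[OF order_refl] by (simp add: T_def)
qed

text \<open>The probability of missing all \<open>A n\<close> in a window is a product of factors
  \<open>1 - P n \<le> exp (- P n)\<close>, where \<open>P n\<close> is the probability of hitting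
  \<open>A n\<close>, and it tends to 0 when the series diverges. The start \<open>m\<close> of the
  index set allows for sequences that begin at 1.\<close>

lemma (in prob_space) borel_cantelli_2:
  assumes indep: "indep_vars N Z {m..}"
    and A: "\<And>n. n \<ge> m \<Longrightarrow> A n \<in> sets (N n)"
    and div: "\<not> summable (\<lambda>n. prob (Z n -` A n \<inter> space M))"
  shows "AE \<omega> in M. \<exists>\<^sub>\<infinity>n. Z n \<omega> \<in> A n"
proof -
  define P where "P n = prob (Z n -` A n \<inter> space M)" for n
  have Zm: "Z n \<in> measurable M (N n)" if "n \<ge> m" for n
    using indep that by (auto simp: indep_vars_def)
  have "AE \<omega> in M. \<exists>n\<ge>k. Z n \<omega> \<in> A n" if "k \<ge> m" for k
  proof -
    define G where "G j = (\<Inter>n\<in>{k..k+j}. Z n -` (space (N n) - A n) \<inter> space M)" for j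
    have Gm: "G j \<in> events" for j
      unfolding G_def using Zm A that by (intro sets.finite_INT) (auto intro!: measurable_sets)
    have bound: "prob (G j) \<le> exp (- (\<Sum>n\<in>{k..k+j}. P n))" for j
    proof -
      have "prob (G j) = (\<Prod>n\<in>{k..k+j}. prob (Z n -` (space (N n) - A n) \<inter> space M))"
        unfolding G_def using that A by (intro indep_varsD[OF indep]) auto
      also have "\<dots> \<le> (\<Prod>n\<in>{k..k+j}. exp (- P n))"
      proof (intro prod_mono conjI measure_nonneg)
        fix n assume n: "n \<in> {k..k+j}"
        have "Z n -` (space (N n) - A n) \<inter> space M = space M - (Z n -` A n \<inter> space M)"
          using measurable_space[OF Zm[of n]] n that by auto
        then have "prob (Z n -` (space (N n) - A n) \<inter> space M) = 1 - P n"
          using n that A Zm unfolding P_def by (subst prob_compl[symmetric]) (auto intro!: measurable_sets)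
        also have "\<dots> \<le> exp (- P n)"
          using exp_ge_add_one_self[of "- P n"] by simp
        finally show "prob (Z n -` (space (N n) - A n) \<inter> space M) \<le> exp (- P n)" .
      qed
      also have "\<dots> = exp (- (\<Sum>n\<in>{k..k+j}. P n))"
        by (simp add: exp_sum[symmetric] sum_negf)
      finally show ?thesis .
    qed
    have null: "prob (\<Inter>j. G j) = 0"
    proof (rule ccontr)
      assume "prob (\<Inter>j. G j) \<noteq> 0"
      then have pos: "prob (\<Inter>j. G j) > 0" by (simp add: zero_less_measure_iff)
      \<comment> \<open>A positive probability of missing every event from \<open>k\<close> on would
        bound all window sums of \<open>P\<close> by its negative logarithm.\<close>
      have "(\<Sum>n\<in>{k..k+j}. P n) \<le> - ln (prob (\<Inter>j. G j))" for j
      proof -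
        have "prob (\<Inter>j. G j) \<le> prob (G j)"
          using Gm by (intro finite_measure_mono) auto
        then have "prob (\<Inter>j. G j) \<le> exp (- (\<Sum>n\<in>{k..k+j}. P n))"
          using bound order_trans by blast
        then have "ln (prob (\<Inter>j. G j)) \<le> - (\<Sum>n\<in>{k..k+j}. P n)"
          using pos by (metis ln_exp ln_le_cancel_iff exp_gt_zero)
        then show ?thesis by simp
      qed
      then have "(\<Sum>i<j. P (i + k)) \<le> - ln (prob (\<Inter>j. G j))" for j
      proof -
        have "(\<Sum>i<j. P (i + k)) \<le> (\<Sum>n\<in>{k..k+j}. P n)"
          by (rule order_trans[OF _ sum_mono2[of "{k..k+j}" "(\<lambda>i. i + k) ` {..<j}"]])
            (auto simp: sum.reindex P_def)
        then show ?thesis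
          using \<open>\<And>j. (\<Sum>n\<in>{k..k+j}. P n) \<le> - ln (prob (\<Inter>j. G j))\<close>[of j] by linarith
      qed
      then have "summable (\<lambda>i. P (i + k))"
        by (intro summableI_nonneg_bounded) (auto simp: P_def)
      then show False using div summable_iff_shift[of P k] by (simp add: P_def[abs_def])
    qed
    have "AE \<omega> in M. \<omega> \<notin> (\<Inter>j. G j)"
      using null Gm by (subst (asm) prob_eq_0) auto
    with AE_space show ?thesis
    proof eventually_elim
      case (elim \<omega>)
      then obtain j n where "n \<in> {k..k+j}" "\<omega> \<notin> Z n -` (space (N n) - A n) \<inter> space M"
        by (auto simp: G_def)
      then show ?case
        using measurable_space[OF Zm[of n], of \<omega>] elim that by auto
    qed
  qed
  then have "AE \<omega> in M. \<forall>k\<in>{m..}. \<exists>n\<ge>k. Z n \<omega> \<in> A n"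
    by (subst AE_ball_countable) auto
  then show ?thesis
  proof eventually_elim
    case (elim \<omega>)
    show ?case unfolding INFM_nat_le
    proof
      fix k show "\<exists>n\<ge>k. Z n \<omega> \<in> A n"
        using elim[rule_format, of "max m k"] by auto
    qed
  qed
qed

section \<open>Norming sequences\<close>

locale norming_sequence =
  fixes b :: "nat \<Rightarrow> real" and p :: real
  assumes p_ge_1: "1 \<le> p" and p_less_2: "p < 2"
    and b_pos: "n \<ge> 1 \<Longrightarrow> b n > 0"
    and b_strict_mono: "strict_mono_on {1..} b"
    and b_ratio_mono: "mono_on {1..} (\<lambda>n. b n / real n powr (1 / p))"
begin

lemma b_mono: "1 \<le> m \<Longrightarrow> m \<le> n \<Longrightarrow> b m \<le> b n"
  using strict_mono_on_leD[OF b_strict_mono, of m n] by auto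

lemma b_growth:
  assumes "1 \<le> m" "m \<le> n"
  shows "b m * (real n / real m) powr (1 / p) \<le> b n"
proof -
  have "b m / real m powr (1 / p) \<le> b n / real n powr (1 / p)"
    using mono_onD[OF b_ratio_mono, of m n] assms by auto
  then show ?thesis
    using assms by (simp add: field_simps powr_divide)
qed

lemma b_growth_1: "n \<ge> 1 \<Longrightarrow> b 1 * real n powr (1 / p) \<le> b n"
  using b_growth[of 1 n] by simp

lemma b_growth_1_powr:
  assumes "n \<ge> 1"
  shows "b 1 powr p * real n \<le> b n powr p"
proof -
  have "(b 1 * real n powr (1 / p)) powr p \<le> b n powr p"
    using b_growth_1[OF assms] b_pos[of 1] p_ge_1 by (intro powr_mono2) auto
  then show ?thesis
    using b_pos[of 1] p_ge_1 by (simp add: powr_mult powr_powr)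
qed

lemma filterlim_b: "filterlim b at_top sequentially"
proof (rule filterlim_at_top_mono)
  show "filterlim (\<lambda>n. b 1 * real n powr (1 / p)) at_top sequentially"
  proof (rule filterlim_tendsto_pos_mult_at_top[OF tendsto_const])
    show "0 < b 1" using b_pos by simp
    show "filterlim (\<lambda>n. real n powr (1 / p)) at_top sequentially"
      using p_ge_1 by (intro filterlim_compose[OF real_powr_at_top filterlim_real_sequentially]) auto
  qed
  show "eventually (\<lambda>n. b 1 * real n powr (1 / p) \<le> b n) sequentially"
    using eventually_ge_at_top[of 1] by eventually_elim (rule b_growth_1)
qed

text \<open>\<open>b n\<close> is at least of order \<open>n powr (1 / p)\<close>, and
  \<open>1/2 - 1/p < 0\<close> because \<open>p < 2\<close>. Fluctuations of order
  \<open>sqrt n\<close>, such as those of finite-range variables, are therefore negligible.\<close>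

lemma sqrt_over_b_tendsto_0: "(\<lambda>n. sqrt (real n) / b n) \<longlonglongrightarrow> 0"
proof (rule tendsto_sandwich[where f = "\<lambda>_. 0"])
  have "(\<lambda>n. real n powr (1/2 - 1/p)) \<longlonglongrightarrow> 0"
    using p_ge_1 p_less_2 by (intro tendsto_neg_powr filterlim_real_sequentially) (auto simp: field_simps)
  then show "(\<lambda>n. real n powr (1/2 - 1/p) / b 1) \<longlonglongrightarrow> 0"
    using tendsto_divide[OF _ tendsto_const[of "b 1"]] b_pos[of 1] by force
  show "eventually (\<lambda>n. sqrt (real n) / b n \<le> real n powr (1/2 - 1/p) / b 1) sequentially"
    using eventually_ge_at_top[of 1]
  proof eventually_elim
    case (elim n)
    have "sqrt (real n) / b n \<le> sqrt (real n) / (b 1 * real n powr (1 / p))"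
      using b_growth_1[OF elim] b_pos elim by (intro divide_left_mono) auto
    also have "\<dots> = real n powr (1/2 - 1/p) / b 1"
      using elim by (simp add: powr_diff powr_half_sqrt)
    finally show ?case .
  qed
  show "eventually (\<lambda>n. 0 \<le> sqrt (real n) / b n) sequentially"
    using eventually_ge_at_top[of 1] by eventually_elim (simp add: less_imp_le b_pos)
qed simp

text \<open>The number of \<open>n \<ge> 1\<close> with \<open>b n < x\<close>.\<close>

definition crossings :: "real \<Rightarrow> nat"
  where "crossings x = (LEAST k. x \<le> b (Suc k))"

text \<open>Since \<open>b\<close> increases to infinity, the indices \<open>n \<ge> 1\<close> with
  \<open>b n < x\<close> form an initial segment. This equivalence is the working form of the
  definition.\<close>

lemma less_iff_le_crossings:
  assumes "n \<ge> 1"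
  shows "b n < x \<longleftrightarrow> n \<le> crossings x"
proof -
  have "eventually (\<lambda>n. x \<le> b n) sequentially"
    using filterlim_b by (simp add: filterlim_at_top)
  then obtain k where "x \<le> b (Suc k)"
    unfolding eventually_sequentially by (meson le_SucI order_refl)
  then have c: "x \<le> b (Suc (crossings x))"
    unfolding crossings_def by (rule LeastI)
  show ?thesis
  proof
    assume "b n < x"
    with c have "b n < b (Suc (crossings x))" by linarith
    then show "n \<le> crossings x"
      using b_mono[of "Suc (crossings x)" n] by (metis le_add1 not_le not_less_eq_eq plus_1_eq_Suc)
  next
    assume "n \<le> crossings x"
    then have "n - 1 < crossings x" using assms by simp
    then have "\<not> x \<le> b (Suc (n - 1))"
      unfolding crossings_def by (rule not_less_Least)
    then show "b n < x" using assms by simp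
  qed
qed

lemma le_iff_crossings_less: "n \<ge> 1 \<Longrightarrow> x \<le> b n \<longleftrightarrow> crossings x < n"
  using less_iff_le_crossings[of n x] by linarith

lemma measurable_crossings [measurable]: "crossings \<in> measurable borel (count_space UNIV)"
  unfolding crossings_def by measurable

text \<open>Pointwise counting identity; integrated over the law of the norm, it turns the tail
  series into the mean of \<open>crossings\<close>.\<close>

lemma suminf_crossings: "(\<Sum>n. indicator {b (Suc n)<..} x) = ennreal (crossings x)"
proof -
  have "(\<Sum>n. indicator {b (Suc n)<..} x) = (\<Sum>n<crossings x. indicator {b (Suc n)<..} x :: ennreal)"
    using less_iff_le_crossings by (intro suminf_finite) (auto simp: indicator_def not_le)
  also have "\<dots> = (\<Sum>n<crossings x. 1)"
    using less_iff_le_crossings by (intro sum.cong) (auto simp: indicator_def)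
  finally show ?thesis by (simp add: ennreal_of_nat_eq_real_of_nat)
qed

text \<open>A summand is the normalized error of truncating at \<open>b i\<close> instead of
  \<open>b n\<close>. It is at most 1 and is nonzero for at most \<open>crossings x\<close> indices,
  which supplies a majorant for dominated convergence.\<close>

lemma sum_overshoot_le_crossings:
  assumes "0 \<le> x" "n \<ge> 1"
  shows "(\<Sum>i=1..n. if b i < x \<and> x \<le> b n then x / b n else 0) \<le> crossings x"
proof -
  have "(\<Sum>i=1..n. if b i < x \<and> x \<le> b n then x / b n else 0)
      \<le> (\<Sum>i=1..n. if i \<le> crossings x then 1 else 0)"
    using assms b_pos[of n] less_iff_le_crossings by (intro sum_mono) auto
  also have "\<dots> = real (card {i\<in>{1..n}. i \<le> crossings x})"
    by (simp add: sum.If_cases Int_def)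
  also have "\<dots> \<le> real (card {1..crossings x})"
    by (intro of_nat_mono card_mono) auto
  finally show ?thesis by simp
qed

text \<open>Only the finitely many indices counted by \<open>crossings x\<close> contribute, each at
  most \<open>x / b n\<close>, and \<open>b n\<close> tends to infinity.\<close>

lemma sum_overshoot_tendsto_0:
  assumes "0 \<le> x"
  shows "(\<lambda>n. \<Sum>i=1..n. if b i < x \<and> x \<le> b n then x / b n else 0) \<longlonglongrightarrow> 0"
proof (rule tendsto_sandwich[where f = "\<lambda>_. 0"])
  show "eventually (\<lambda>n. (\<Sum>i=1..n. if b i < x \<and> x \<le> b n then x / b n else 0) \<le> real (crossings x) * x / b n) sequentially"
    using eventually_ge_at_top[of 1]
  proof eventually_elim
    case (elim n)
    have "(\<Sum>i=1..n. if b i < x \<and> x \<le> b n then x / b n else 0)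
        \<le> (\<Sum>i=1..n. if i \<le> crossings x then x / b n else 0)"
      using assms elim b_pos[of n] less_iff_le_crossings by (intro sum_mono) auto
    also have "\<dots> = real (card {i\<in>{1..n}. i \<le> crossings x}) * (x / b n)"
      by (simp add: sum.If_cases Int_def)
    also have "\<dots> \<le> real (card {1..crossings x}) * (x / b n)"
      using assms elim b_pos[of n] by (intro mult_right_mono of_nat_mono card_mono) auto
    finally show ?case by simp
  qed
  show "(\<lambda>n. real (crossings x) * x / b n) \<longlonglongrightarrow> 0"
    by (intro tendsto_divide_0[OF tendsto_const] filterlim_at_top_imp_at_infinity filterlim_b)
  show "eventually (\<lambda>n. 0 \<le> (\<Sum>i=1..n. if b i < x \<and> x \<le> b n then x / b n else 0)) sequentially"
    using eventually_ge_at_top[of 1]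
    by eventually_elim (auto intro!: sum_nonneg simp: assms less_imp_le b_pos)
qed simp

text \<open>At index \<open>crossings x + 1\<close> the sequence \<open>b\<close> first reaches
  \<open>x\<close>, so the growth of \<open>b\<close> from there to \<open>n\<close> can be applied
  to \<open>x\<close>.\<close>

lemma crossings_growth:
  assumes "0 \<le> x" "n \<ge> 1" "x \<le> b n"
  shows "x * (real n / (real (crossings x) + 1)) powr (1 / p) \<le> b n"
proof -
  let ?k = "Suc (crossings x)"
  have "?k \<le> n" using le_iff_crossings_less[of n x] assms by simp
  have "x \<le> b ?k" using le_iff_crossings_less[of ?k x] by simp
  then have "x * (real n / real ?k) powr (1 / p) \<le> b ?k * (real n / real ?k) powr (1 / p)"
    by (rule mult_right_mono) simp
  also have "\<dots> \<le> b n" using b_growth[of ?k n] \<open>?k \<le> n\<close> by simp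
  finally show ?thesis by (simp add: add.commute)
qed

text \<open>The p-th power of the preceding growth bound; through it \<open>crossings\<close>
  controls \<open>n\<close> times a truncated p-th moment.\<close>

lemma mult_powr_le_crossings:
  assumes "0 \<le> x" "n \<ge> 1" "x \<le> b n"
  shows "real n * x powr p \<le> (real (crossings x) + 1) * b n powr p"
proof -
  have "(x * (real n / (real (crossings x) + 1)) powr (1 / p)) powr p \<le> b n powr p"
    using crossings_growth[OF assms] assms p_ge_1 by (intro powr_mono2) auto
  then have "x powr p * (real n / (real (crossings x) + 1)) \<le> b n powr p"
    using assms p_ge_1 by (simp add: powr_mult powr_powr)
  then show ?thesis by (simp add: field_simps)
qed

end

lemma powr_neg_le_diff:
  fixes r :: real
  assumes "1 < r" "n \<ge> 1"
  shows "real (Suc n) powr (- r) \<le> (real n powr (1 - r) - real (Suc n) powr (1 - r)) / (r - 1)"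
proof -
  have "\<exists>z. real n < z \<and> z < real (Suc n) \<and>
      real (Suc n) powr (1 - r) - real n powr (1 - r) = (real (Suc n) - real n) * ((1 - r) * z powr (1 - r - 1))"
    using assms by (intro MVT2) (auto intro!: derivative_eq_intros)
  then obtain z where z: "real n < z" "z < real (Suc n)"
      "real (Suc n) powr (1 - r) - real n powr (1 - r) = (1 - r) * z powr (- r)"
    by auto
  have "real (Suc n) powr (- r) \<le> z powr (- r)"
    using z assms by (intro powr_mono2') auto
  then have "(r - 1) * real (Suc n) powr (- r) \<le> (r - 1) * z powr (- r)"
    using assms by (intro mult_left_mono) auto
  also have "\<dots> = real n powr (1 - r) - real (Suc n) powr (1 - r)"
    using z(3) by (simp add: algebra_simps)
  finally show ?thesis using assms by (simp add: field_simps)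
qed

text \<open>The terms after the first are dominated by a telescoping sum from the mean value
  theorem; the first one is absorbed using \<open>k \<ge> 1\<close>.\<close>

lemma sum_powr_tail_le:
  fixes r :: real
  assumes "1 < r" "k \<ge> 1"
  shows "(\<Sum>i=k..n. real i powr (- r)) \<le> (1 + 1 / (r - 1)) * real k powr (1 - r)"
proof (cases "k \<le> n")
  case True
  then have "(\<Sum>i=k..n. real i powr (- r))
      \<le> real k powr (- r) + (real k powr (1 - r) - real n powr (1 - r)) / (r - 1)"
  proof (induction n rule: dec_induct)
    case (step n)
    then show ?case
      using powr_neg_le_diff[of r n] assms by (simp add: diff_divide_distrib)
  qed simp
  also have "\<dots> \<le> real k powr (1 - r) + real k powr (1 - r) / (r - 1)"
    using assms by (intro add_mono divide_right_mono powr_mono) auto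
  finally show ?thesis by (simp add: algebra_simps)
qed (use assms in simp)

text \<open>With \<open>k = crossings x + 1\<close>, only indices \<open>i \<ge> k\<close>
  contribute, each at most \<open>(k / i) powr (2 / p)\<close>. As \<open>2 / p > 1\<close>, the
  tail sum of \<open>i powr (- (2 / p))\<close> is of order \<open>k powr (1 - 2 / p)\<close>, and
  the powers of \<open>k\<close> combine to \<open>k\<close>.\<close>

lemma (in norming_sequence) sum_square_ratio_le_crossings:
  assumes "0 \<le> x"
  shows "(\<Sum>i=1..n. if x \<le> b i then x\<^sup>2 / (b i)\<^sup>2 else 0)
    \<le> (1 + 1 / (2 / p - 1)) * (real (crossings x) + 1)"
proof -
  let ?k = "Suc (crossings x)" and ?r = "2 / p"
  have r: "1 < ?r" using p_ge_1 p_less_2 by (simp add: field_simps)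
  have summand: "x\<^sup>2 / (b i)\<^sup>2 \<le> real ?k powr ?r * real i powr (- ?r)" if "i \<ge> 1" "x \<le> b i" for i
  proof -
    have "(x * (real i / real ?k) powr (1 / p))\<^sup>2 \<le> (b i)\<^sup>2"
      using crossings_growth[of x i] that assms by (intro power_mono) (auto simp: add.commute)
    moreover have "((real i / real ?k) powr (1 / p))\<^sup>2 = real i powr ?r / real ?k powr ?r"
      by (simp add: powr_divide power2_eq_square powr_add[symmetric])
    ultimately have "x\<^sup>2 * (real i powr ?r / real ?k powr ?r) \<le> (b i)\<^sup>2"
      by (simp only: power_mult_distrib)
    then show ?thesis
      using b_pos[of i] that(1) by (simp add: field_simps powr_minus)
  qed
  have "(\<Sum>i=1..n. if x \<le> b i then x\<^sup>2 / (b i)\<^sup>2 else 0)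
      = (\<Sum>i\<in>{i\<in>{1..n}. x \<le> b i}. x\<^sup>2 / (b i)\<^sup>2)"
    by (simp add: sum.If_cases Int_def)
  also have "{i\<in>{1..n}. x \<le> b i} = {?k..n}"
    using le_iff_crossings_less by auto
  also have "(\<Sum>i=?k..n. x\<^sup>2 / (b i)\<^sup>2) \<le> (\<Sum>i=?k..n. real ?k powr ?r * real i powr (- ?r))"
    using le_iff_crossings_less by (intro sum_mono summand) auto
  also have "\<dots> = real ?k powr ?r * (\<Sum>i=?k..n. real i powr (- ?r))"
    by (simp add: sum_distrib_left)
  also have "\<dots> \<le> real ?k powr ?r * ((1 + 1 / (?r - 1)) * real ?k powr (1 - ?r))"
    by (intro mult_left_mono sum_powr_tail_le r) auto
  also have "\<dots> = (1 + 1 / (?r - 1)) * (real ?k powr ?r * real ?k powr (1 - ?r))"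
    by (simp only: mult_ac)
  also have "real ?k powr ?r * real ?k powr (1 - ?r) = real (crossings x) + 1"
    by (simp add: powr_add[symmetric])
  finally show ?thesis .
qed

text \<open>A geometric tail with ratio 1/4 is at most 4/3 of its first term. At the least
  admissible index \<open>k0\<close> the condition \<open>x < 2 ^ Suc k0\<close> gives
  \<open>(1/4) ^ k0 \<le> 4 / x\<^sup>2\<close>.\<close>

lemma sum_dyadic_le:
  fixes x :: real
  assumes "0 < x"
  shows "(\<Sum>k<m. if x < 2 ^ Suc k then (1/4) ^ k else 0) \<le> 16 / (3 * x\<^sup>2)"
proof -
  obtain k where "x < 2 ^ k"
    using real_arch_pow[of 2 x] by auto
  then have "x < 2 ^ Suc k"
    using zero_less_power[of "2::real" k] by (simp add: less_trans[of _ "2 ^ k"])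
  define k0 where "k0 = (LEAST k. x < 2 ^ Suc k)"
  have k0: "x < 2 ^ Suc k0" and k0_le: "k0 \<le> k" if "x < 2 ^ Suc k" for k
    using that unfolding k0_def by (auto intro: LeastI Least_le)
  note k0 = k0[OF \<open>x < 2 ^ Suc k\<close>]
  have "(\<Sum>k<m. if x < 2 ^ Suc k then (1/4) ^ k else 0) \<le> (\<Sum>k=k0..<m. (1/4::real) ^ k)"
    unfolding sum.If_cases[OF finite_lessThan] by (auto intro!: sum_mono2 simp: k0_le)
  also have "\<dots> \<le> 4/3 * (1/4) ^ k0"
  proof (cases "k0 \<le> m")
    case True
    have "(\<Sum>k=k0..<m. (1/4::real) ^ k) = (\<Sum>k=k0..<m. (- (4/3) * (1/4) ^ Suc k) - (- (4/3) * (1/4) ^ k))"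
      by (intro sum.cong) auto
    also have "\<dots> = - (4/3) * (1/4) ^ m - (- (4/3) * (1/4) ^ k0)"
      by (rule sum_Suc_diff'[OF True])
    finally show ?thesis by simp
  qed simp
  also have "(1/4::real) ^ k0 \<le> 4 / x\<^sup>2"
  proof -
    have "x\<^sup>2 \<le> (2 ^ Suc k0)\<^sup>2" using k0 assms by (intro power_mono) auto
    also have "\<dots> = 4 * (4::real) ^ k0"
      by (simp add: power_mult_distrib power_mult[symmetric] power2_eq_square power_mult_distrib[symmetric])
    finally show ?thesis using assms by (simp add: field_simps power_divide)
  qed
  finally show ?thesis by simp
qed

section \<open>Truncation\<close>

locale iid_norming = norming_sequence b p + prob_space M
  for b p and M :: "'a measure" +
  fixes X :: "'a \<Rightarrow> 'b::{banach, second_countable_topology}" and Xs :: "nat \<Rightarrow> 'a \<Rightarrow> 'b"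
  assumes iid: "iid_sequence M X Xs"
begin

lemma X_measurable [measurable]: "X \<in> borel_measurable M"
  using iid by (simp add: iid_sequence_def)

lemma indep_Xs: "indep_vars (\<lambda>_. borel) Xs {1..}"
  using iid by (simp add: iid_sequence_def)

lemma Xs_measurable: "i \<ge> 1 \<Longrightarrow> Xs i \<in> borel_measurable M"
  using indep_Xs by (auto simp: indep_vars_def)

lemma distr_Xs: "i \<ge> 1 \<Longrightarrow> distr M borel (Xs i) = distr M borel X"
  using iid by (simp add: iid_sequence_def)

lemma expectation_Xs:
  fixes f :: "'b \<Rightarrow> 'c::{banach, second_countable_topology}"
  assumes "i \<ge> 1" "f \<in> borel_measurable borel"
  shows "expectation (\<lambda>\<omega>. f (Xs i \<omega>)) = expectation (\<lambda>\<omega>. f (X \<omega>))"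
  using integral_distr[OF Xs_measurable assms(2)] integral_distr[OF X_measurable assms(2)]
    distr_Xs assms(1) by simp

lemma prob_Xs:
  assumes "i \<ge> 1" "A \<in> sets borel"
  shows "prob (Xs i -` A \<inter> space M) = prob (X -` A \<inter> space M)"
  using measure_distr[OF Xs_measurable assms(2)] measure_distr[OF X_measurable assms(2)]
    distr_Xs assms(1) by simp

definition trunc :: "nat \<Rightarrow> 'b \<Rightarrow> 'b"
  where "trunc n x = (if norm x \<le> b n then x else 0)"

lemma trunc_measurable [measurable]: "trunc n \<in> borel_measurable borel"
  unfolding trunc_def by measurable

lemma norm_trunc_le: "n \<ge> 1 \<Longrightarrow> norm (trunc n x) \<le> b n"
  using b_pos[of n] by (simp add: trunc_def less_imp_le)

lemma integrable_trunc: "n \<ge> 1 \<Longrightarrow> integrable M (\<lambda>\<omega>. trunc n (X \<omega>))"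
  by (rule integrable_bounded[OF _ norm_trunc_le]) auto

lemma centering_eq: "centering M X b n = real n *\<^sub>R expectation (\<lambda>\<omega>. trunc n (X \<omega>))"
  unfolding centering_def trunc_def
  by (intro arg_cong[where f = "\<lambda>x. real n *\<^sub>R x"] Bochner_Integration.integral_cong) auto

lemma suminf_tail_eq:
  "(\<Sum>n. emeasure M {\<omega> \<in> space M. norm (X \<omega>) > b (Suc n)})
    = (\<integral>\<^sup>+\<omega>. ennreal (real (crossings (norm (X \<omega>)))) \<partial>M)"
proof -
  have "emeasure M {\<omega> \<in> space M. norm (X \<omega>) > b (Suc n)}
      = (\<integral>\<^sup>+\<omega>. indicator {b (Suc n)<..} (norm (X \<omega>)) \<partial>M)" for n
  proof -
    have "(\<integral>\<^sup>+\<omega>. indicator {b (Suc n)<..} (norm (X \<omega>)) \<partial>M)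
        = (\<integral>\<^sup>+\<omega>. indicator {\<omega> \<in> space M. norm (X \<omega>) > b (Suc n)} \<omega> \<partial>M)"
      by (intro nn_integral_cong) (simp add: indicator_def)
    then show ?thesis by (simp add: nn_integral_indicator)
  qed
  then show ?thesis
    by (simp add: nn_integral_suminf[symmetric] suminf_crossings)
qed

lemma integrable_crossings_iff:
  "integrable M (\<lambda>\<omega>. real (crossings (norm (X \<omega>))))
    \<longleftrightarrow> (\<Sum>n. emeasure M {\<omega> \<in> space M. norm (X \<omega>) > b (Suc n)}) < \<infinity>"
  unfolding suminf_tail_eq by (subst integrable_iff_bounded) auto

text \<open>Simple functions that approximate the identity and at most double the norm are cut to 0
  outside the ball of radius \<open>b J\<close>; dominated convergence makes them close in the p-th
  mean. The approximation is a map on the Banach space, so that the same map can be applied to every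
  \<open>Xs i\<close>.\<close>

lemma trunc_simple_approximation:
  assumes "J \<ge> 1" "0 < \<eta>"
  obtains s :: "'b \<Rightarrow> 'b" where "s \<in> borel_measurable borel" "finite (range s)"
    "\<And>x. norm (s x) \<le> 2 * b J" "\<And>x. b J < norm x \<Longrightarrow> s x = 0"
    "expectation (\<lambda>\<omega>. norm (trunc J (X \<omega>) - s (X \<omega>)) powr p) \<le> \<eta>"
proof -
  obtain F :: "nat \<Rightarrow> 'b \<Rightarrow> 'b" where F: "\<And>i. simple_function borel (F i)" "\<And>x. (\<lambda>i. F i x) \<longlonglongrightarrow> x"
    "\<And>i x. dist (F i x) 0 \<le> 2 * dist x 0"
    using borel_measurable_implies_sequence_metric[of "\<lambda>x. x :: 'b" borel 0] by auto
  define s where "s m x = (if norm x \<le> b J then F m x else 0)" for m x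
  have bJ: "b J > 0" using b_pos assms by simp
  have [measurable]: "F m \<in> borel_measurable borel" for m
    using F(1) by (rule borel_measurable_simple_function)
  have s[measurable]: "s m \<in> borel_measurable borel" for m
    unfolding s_def by measurable
  have fin: "finite (range (s m))" for m
  proof (rule finite_subset)
    show "range (s m) \<subseteq> insert 0 (F m ` UNIV)" by (auto simp: s_def)
    show "finite (insert 0 (F m ` UNIV))"
      using simple_functionD(1)[OF F(1)] by simp
  qed
  have bd: "norm (s m x) \<le> 2 * b J" for m x
    using F(3)[of m x] bJ by (auto simp: s_def)
  have bd3: "norm (trunc J x - s m x) \<le> 3 * b J" for m x
    using norm_triangle_ineq4[of "trunc J x" "s m x"] bd[of m x] norm_trunc_le[OF assms(1), of x] by linarith
  have "(\<lambda>m. expectation (\<lambda>\<omega>. norm (trunc J (X \<omega>) - s m (X \<omega>)) powr p)) \<longlonglongrightarrow> expectation (\<lambda>\<omega>. 0)"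
  proof (rule integral_dominated_convergence[where w = "\<lambda>_. (3 * b J) powr p"])
    show "AE \<omega> in M. norm (norm (trunc J (X \<omega>) - s m (X \<omega>)) powr p) \<le> (3 * b J) powr p" for m
      using bd3 p_ge_1 by (auto intro!: powr_mono2)
    have "(\<lambda>m. trunc J x - s m x) \<longlonglongrightarrow> 0" for x
      using tendsto_diff[OF tendsto_const F(2), of x x] by (simp add: trunc_def s_def)
    then have "(\<lambda>m. norm (trunc J x - s m x) powr p) \<longlonglongrightarrow> 0" for x
      using p_ge_1 by (intro tendsto_zero_powrI[OF tendsto_norm_zero tendsto_const]) auto
    then show "AE \<omega> in M. (\<lambda>m. norm (trunc J (X \<omega>) - s m (X \<omega>)) powr p) \<longlonglongrightarrow> 0"
      by simp
  qed auto
  then have "eventually (\<lambda>m. expectation (\<lambda>\<omega>. norm (trunc J (X \<omega>) - s m (X \<omega>)) powr p) < \<eta>) sequentially"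
    using assms(2) by (intro order_tendstoD) auto
  then obtain m where "expectation (\<lambda>\<omega>. norm (trunc J (X \<omega>) - s m (X \<omega>)) powr p) \<le> \<eta>"
    by (auto simp: eventually_sequentially intro: less_imp_le)
  then show thesis
    using s fin bd by (intro that[of "s m"]) (auto simp: s_def)
qed

text \<open>The truncation level moves with the index, so a summand does not change with
  \<open>n\<close>. In \<open>centering\<close> all truncations are at level \<open>n\<close>; the
  resulting difference of means is treated as a separate drift.\<close>

definition centered_sum :: "nat \<Rightarrow> 'a \<Rightarrow> 'b"
  where "centered_sum n \<omega> = (\<Sum>i=1..n. trunc i (Xs i \<omega>) - expectation (\<lambda>\<omega>. trunc i (X \<omega>)))"

lemma centered_sum_measurable [measurable]: "centered_sum n \<in> borel_measurable M"
proof -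
  have [measurable]: "Xs i \<in> borel_measurable M" if "i \<in> {1..n}" for i
    using that Xs_measurable by auto
  show ?thesis unfolding centered_sum_def[abs_def] by measurable
qed

lemma integrable_of_Xs:
  fixes f :: "'b \<Rightarrow> 'c::{banach, second_countable_topology}"
  assumes "i \<ge> 1" "f \<in> borel_measurable borel" "\<And>x. norm (f x) \<le> K"
  shows "integrable M (\<lambda>\<omega>. f (Xs i \<omega>))"
  using assms Xs_measurable[of i] by (intro integrable_bounded[of _ K]) auto

lemma integrable_of_X:
  fixes f :: "'b \<Rightarrow> 'c::{banach, second_countable_topology}"
  assumes "f \<in> borel_measurable borel" "\<And>x. norm (f x) \<le> K"
  shows "integrable M (\<lambda>\<omega>. f (X \<omega>))"
  using assms by (intro integrable_bounded[of _ K]) auto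

lemma indep_of_Xs:
  assumes "\<And>i. i \<ge> 1 \<Longrightarrow> f i \<in> borel_measurable borel"
  shows "indep_vars (\<lambda>_. borel) (\<lambda>i \<omega>. f i (Xs i \<omega>)) {1..n::nat}"
  using assms by (intro indep_vars_subset[OF indep_vars_compose2[OF indep_Xs]]) auto

lemma norm_centered_sum_bounded: "\<exists>K. \<forall>\<omega>. norm (centered_sum n \<omega>) \<le> K"
proof (intro exI allI)
  fix \<omega>
  have "norm (centered_sum n \<omega>) \<le> (\<Sum>i=1..n. norm (trunc i (Xs i \<omega>) - expectation (\<lambda>\<omega>. trunc i (X \<omega>))))"
    unfolding centered_sum_def by (rule norm_sum)
  also have "\<dots> \<le> (\<Sum>i=1..n. b i + norm (expectation (\<lambda>\<omega>. trunc i (X \<omega>))))"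
    by (intro sum_mono order_trans[OF norm_triangle_ineq4] add_mono norm_trunc_le) auto
  finally show "norm (centered_sum n \<omega>) \<le> \<dots>" .
qed

text \<open>Centering is a translation, so the norm of the centered sum is a 1-Lipschitz function of
  the uncentered sum; hence uncentered second moments appear on the right.\<close>

lemma variance_norm_centered_sum_le:
  "variance (\<lambda>\<omega>. norm (centered_sum n \<omega>)) \<le> (\<Sum>i=1..n. expectation (\<lambda>\<omega>. (norm (trunc i (X \<omega>)))\<^sup>2))"
proof (cases "n = 0")
  case False
  define c where "c = (\<Sum>i=1..n. expectation (\<lambda>\<omega>. trunc i (X \<omega>)))"
  have "variance (\<lambda>\<omega>. norm ((\<Sum>i=1..n. trunc i (Xs i \<omega>)) - c))
      \<le> (\<Sum>i=1..n. expectation (\<lambda>\<omega>. (norm (trunc i (Xs i \<omega>)))\<^sup>2))"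
  proof (rule variance_lipschitz_sum[where \<phi> = "\<lambda>s. norm (s - c)" and I = "{1..n}" and K = "b n"])
    show "indep_vars (\<lambda>_. borel) (\<lambda>i \<omega>. trunc i (Xs i \<omega>)) {1..n}"
      by (rule indep_of_Xs) simp
    show "norm (trunc i (Xs i \<omega>)) \<le> b n" if "i \<in> {1..n}" for i \<omega>
      using norm_trunc_le[of i "Xs i \<omega>"] b_mono[of i n] that by auto
    show "1-lipschitz_on UNIV (\<lambda>s. norm (s - c))"
    proof (rule lipschitz_onI)
      show "dist (norm (x - c)) (norm (y - c)) \<le> 1 * dist x y" for x y
        using norm_triangle_ineq3[of "x - c" "y - c"] by (simp add: dist_norm)
    qed simp
  qed auto
  also have "\<dots> = (\<Sum>i=1..n. expectation (\<lambda>\<omega>. (norm (trunc i (X \<omega>)))\<^sup>2))"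
    by (intro sum.cong refl expectation_Xs[of _ "\<lambda>x. (norm (trunc _ x))\<^sup>2"]) auto
  also have "(\<lambda>\<omega>. (\<Sum>i=1..n. trunc i (Xs i \<omega>)) - c) = centered_sum n"
    by (simp add: centered_sum_def[abs_def] c_def sum_subtractf)
  then have "(\<lambda>\<omega>. norm ((\<Sum>i=1..n. trunc i (Xs i \<omega>)) - c)) = (\<lambda>\<omega>. norm (centered_sum n \<omega>))"
    by (metis (no_types))
  finally show ?thesis by simp
qed (simp add: centered_sum_def)

end

locale iid_norming_summable = iid_norming +
  assumes crossings_integrable: "integrable M (\<lambda>\<omega>. real (crossings (norm (X \<omega>))))"
begin

text \<open>The truncations of \<open>X\<close> at \<open>b i\<close> and \<open>b n\<close> differ
  exactly when the norm lies between the two levels. The drift is thus at most the mean of an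
  overshoot sum, which tends to 0 by dominated convergence with majorant
  \<open>crossings\<close>.\<close>

lemma mean_drift_tendsto_0:
  "(\<lambda>n. ((\<Sum>i=1..n. expectation (\<lambda>\<omega>. trunc i (X \<omega>))) - centering M X b n) /\<^sub>R b n) \<longlonglongrightarrow> 0"
proof (rule tendsto_norm_zero_cancel, rule tendsto_sandwich[where f = "\<lambda>_. 0"])
  define h where "h n x = (\<Sum>i=1..n. if b i < x \<and> x \<le> b n then x / b n else 0)" for n x
  have [measurable]: "h n \<in> borel_measurable borel" for n
    unfolding h_def by measurable
  \<comment> \<open>\<open>max 1 n\<close> keeps the majorant valid at \<open>n = 0\<close>, where
    nothing is assumed about \<open>b\<close>.\<close>
  have "(\<lambda>n. expectation (\<lambda>\<omega>. h (max 1 n) (norm (X \<omega>)))) \<longlonglongrightarrow> expectation (\<lambda>\<omega>. 0)"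
  proof (rule integral_dominated_convergence[OF _ _ crossings_integrable])
    have "h n x \<ge> 0" if "n \<ge> 1" "x \<ge> 0" for n x
      unfolding h_def using that b_pos[of n] by (intro sum_nonneg) auto
    moreover have "h n x \<le> real (crossings x)" if "n \<ge> 1" "x \<ge> 0" for n x
      unfolding h_def using that by (intro sum_overshoot_le_crossings)
    ultimately show "AE \<omega> in M. norm (h (max 1 n) (norm (X \<omega>))) \<le> real (crossings (norm (X \<omega>)))" for n
      by (intro AE_I2) simp
    have "(\<lambda>n. h n x) \<longlonglongrightarrow> 0" if "x \<ge> 0" for x
      unfolding h_def by (rule sum_overshoot_tendsto_0[OF that])
    moreover have "eventually (\<lambda>n. h (max 1 n) x = h n x) sequentially" for x
      using eventually_ge_at_top[of 1] by eventually_elim (simp add: max_def)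
    ultimately have "(\<lambda>n. h (max 1 n) x) \<longlonglongrightarrow> 0" if "x \<ge> 0" for x
      using that by (subst tendsto_cong[of _ "\<lambda>n. h n x"])
    then show "AE \<omega> in M. (\<lambda>n. h (max 1 n) (norm (X \<omega>))) \<longlonglongrightarrow> 0"
      by simp
  qed auto
  then show "(\<lambda>n. expectation (\<lambda>\<omega>. h (max 1 n) (norm (X \<omega>)))) \<longlonglongrightarrow> 0"
    by simp
  show "eventually (\<lambda>n. norm (((\<Sum>i=1..n. expectation (\<lambda>\<omega>. trunc i (X \<omega>))) - centering M X b n) /\<^sub>R b n)
      \<le> expectation (\<lambda>\<omega>. h (max 1 n) (norm (X \<omega>)))) sequentially"
    using eventually_ge_at_top[of 1]
  proof eventually_elim
    case (elim n)
    have bn: "b n > 0" using b_pos elim by simp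
    define d where "d i \<omega> = trunc i (X \<omega>) - trunc n (X \<omega>)" for i \<omega>
    have d: "integrable M (d i)" if "i \<in> {1..n}" for i
      unfolding d_def using that elim by (intro Bochner_Integration.integrable_diff integrable_trunc) auto
    have "(\<Sum>i=1..n. expectation (\<lambda>\<omega>. trunc i (X \<omega>))) - centering M X b n
        = (\<Sum>i=1..n. expectation (\<lambda>\<omega>. trunc i (X \<omega>)) - expectation (\<lambda>\<omega>. trunc n (X \<omega>)))"
      by (simp only: sum_subtractf centering_eq sum_constant_scaleR) simp
    also have "\<dots> = (\<Sum>i=1..n. expectation (d i))"
      unfolding d_def using elim
      by (intro sum.cong refl Bochner_Integration.integral_diff[symmetric] integrable_trunc) auto
    also have "\<dots> = expectation (\<lambda>\<omega>. \<Sum>i=1..n. d i \<omega>)"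
      using d by (intro Bochner_Integration.integral_sum[symmetric]) auto
    finally have eq: "(\<Sum>i=1..n. expectation (\<lambda>\<omega>. trunc i (X \<omega>))) - centering M X b n
        = expectation (\<lambda>\<omega>. \<Sum>i=1..n. d i \<omega>)" .
    have dn: "norm (d i \<omega>) / b n = (if b i < norm (X \<omega>) \<and> norm (X \<omega>) \<le> b n then norm (X \<omega>) / b n else 0)"
      if "i \<in> {1..n}" for i \<omega>
      using b_mono[of i n] that by (auto simp: d_def trunc_def)
    have "norm (expectation (\<lambda>\<omega>. \<Sum>i=1..n. d i \<omega>)) \<le> expectation (\<lambda>\<omega>. norm (\<Sum>i=1..n. d i \<omega>))"
      by (rule integral_norm_bound)
    also have "\<dots> \<le> expectation (\<lambda>\<omega>. b n * h n (norm (X \<omega>)))"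
    proof (rule integral_mono)
      show "integrable M (\<lambda>\<omega>. norm (\<Sum>i=1..n. d i \<omega>))"
        using d by (intro integrable_norm Bochner_Integration.integrable_sum) auto
      have hs: "h n (norm (X \<omega>)) = (\<Sum>i=1..n. norm (d i \<omega>) / b n)" for \<omega>
        unfolding h_def by (intro sum.cong) (auto simp: dn)
      show "integrable M (\<lambda>\<omega>. b n * h n (norm (X \<omega>)))"
        unfolding hs using d by (intro integrable_mult_right Bochner_Integration.integrable_sum integrable_divide integrable_norm) auto
      show "norm (\<Sum>i=1..n. d i \<omega>) \<le> b n * h n (norm (X \<omega>))" for \<omega>
        unfolding hs using bn by (simp add: sum_divide_distrib[symmetric] norm_sum)
    qed
    also have "\<dots> = b n * expectation (\<lambda>\<omega>. h (max 1 n) (norm (X \<omega>)))"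
      using elim by (simp add: max_def)
    finally show ?case
      unfolding eq using bn by (simp add: field_simps)
  qed
qed auto

lemma tail_crossings_tendsto_0:
  "(\<lambda>J. expectation (\<lambda>\<omega>. if b J < norm (X \<omega>) then real (crossings (norm (X \<omega>))) + 1 else 0)) \<longlonglongrightarrow> 0"
proof -
  have "(\<lambda>J. expectation (\<lambda>\<omega>. if b J < norm (X \<omega>) then real (crossings (norm (X \<omega>))) + 1 else 0))
      \<longlonglongrightarrow> expectation (\<lambda>\<omega>. 0)"
  proof (rule integral_dominated_convergence[where w = "\<lambda>\<omega>. real (crossings (norm (X \<omega>))) + 1"])
    show "integrable M (\<lambda>\<omega>. real (crossings (norm (X \<omega>))) + 1)"
      using crossings_integrable by simp
    have "eventually (\<lambda>J. (if b J < x then c else 0) = 0) sequentially" for x and c :: real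
    proof -
      have "eventually (\<lambda>J. x \<le> b J) sequentially"
        using filterlim_b by (simp add: filterlim_at_top)
      then show ?thesis by eventually_elim simp
    qed
    then show "AE \<omega> in M. (\<lambda>J. if b J < norm (X \<omega>) then real (crossings (norm (X \<omega>))) + 1 else 0) \<longlonglongrightarrow> 0"
      by (intro AE_I2 tendsto_eventually)
  qed auto
  then show ?thesis by simp
qed

end

section \<open>Weak law\<close>

context iid_norming_summable
begin

text \<open>Type \<open>p\<close> alone would only bound the quotient, so the part of the variables within a large
  but fixed ball is first replaced by a variable with finite range, for which \<open>\<surd>n\<close> is the right
  order of magnitude.\<close>

lemma expectation_centered_sum_tendsto_0:
  fixes N :: "'w measure"
  assumes R: "rademacher_sequence N R" and "0 < C"
    and C: "\<And>n (v :: nat \<Rightarrow> 'b). (\<integral>\<^sup>+w. ennreal (norm (\<Sum>i=1..n. R i w *\<^sub>R v i) powr p) \<partial>N)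
      \<le> ennreal (C * (\<Sum>i=1..n. norm (v i) powr p))"
  shows "(\<lambda>n. expectation (\<lambda>\<omega>. norm (centered_sum n \<omega>)) / b n) \<longlonglongrightarrow> 0"
proof (rule LIMSEQ_I)
  fix \<epsilon> :: real assume "0 < \<epsilon>"
  \<comment> \<open>\<open>\<delta>\<close> is chosen so that
    \<open>8 * \<delta> = \<epsilon> / 2\<close>, and \<open>\<theta>\<close> so that three moment
    contributions of size \<open>\<theta> * b n powr p\<close> satisfy
    \<open>C * (3 * \<theta> * b n powr p) = (\<delta> * b n) powr p\<close>.\<close>
  define \<delta> where "\<delta> = \<epsilon> / 16"
  define \<theta> where "\<theta> = \<delta> powr p / (3 * C)"
  have \<delta>: "0 < \<delta>" and \<theta>: "0 < \<theta>" using \<open>0 < \<epsilon>\<close> \<open>0 < C\<close> by (auto simp: \<delta>_def \<theta>_def)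
  define G where "G J = expectation (\<lambda>\<omega>. if b J < norm (X \<omega>) then real (crossings (norm (X \<omega>))) + 1 else 0)" for J
  have "eventually (\<lambda>J. G J < \<theta>) sequentially"
    unfolding G_def using \<theta> by (intro order_tendstoD(2)[OF tail_crossings_tendsto_0]) auto
  then have "eventually (\<lambda>J. G J < \<theta> \<and> J \<ge> 1) sequentially"
    using eventually_ge_at_top by (rule eventually_conj)
  then obtain J where J: "G J < \<theta>" "J \<ge> 1"
    by (auto simp: eventually_sequentially)
  define B where "B = b J"
  have B: "B > 0" using b_pos J by (simp add: B_def)
  \<comment> \<open>The tolerance contains \<open>b 1 powr p\<close> because
    \<open>real n * b 1 powr p \<le> b n powr p\<close>: the sum of \<open>n\<close> such errors
    stays below \<open>\<theta> * b n powr p\<close>.\<close>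
  have "0 < \<theta> * b 1 powr p" using \<theta> b_pos[of 1] by simp
  then obtain s where s[measurable]: "s \<in> borel_measurable borel" and s_fin: "finite (range s)"
    and s_bd: "\<And>x. norm (s x) \<le> 2 * B" and s_0: "\<And>x. B < norm x \<Longrightarrow> s x = 0"
    and s_approx: "expectation (\<lambda>\<omega>. norm (trunc J (X \<omega>) - s (X \<omega>)) powr p) \<le> \<theta> * b 1 powr p"
    unfolding B_def by (rule trunc_simple_approximation[OF J(2)]) blast
  define c0 where "c0 = (\<Sum>v\<in>range s. norm v)"
  define K where "K = (3 * B) powr p"
  have z_bd: "norm (trunc i x - s x) \<le> b i + 2 * B" if "i \<ge> 1" for i x
    using norm_triangle_ineq4[of "trunc i x" "s x"] norm_trunc_le[OF that, of x] s_bd[of x] by linarith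
  have main: "expectation (\<lambda>\<omega>. norm (centered_sum n \<omega>)) \<le> 2 * sqrt (real n) * c0 + 8 * \<delta> * b n"
    if n: "n \<ge> J" "real J * K \<le> \<theta> * b n powr p" for n
  proof -
    have n1: "n \<ge> 1" using J n by simp
    have bn: "b n > 0" using b_pos n1 by simp
    define tail where "tail x = (if B < norm x \<and> norm x \<le> b n then norm x powr p else 0)" for x :: 'b
    have [measurable]: "tail \<in> borel_measurable borel"
      unfolding tail_def by measurable
    have tail_bd: "norm (tail x) \<le> b n powr p" for x
      using p_ge_1 by (auto simp: tail_def intro: powr_mono2)
    \<comment> \<open>Outside the ball \<open>s\<close> vanishes and only \<open>tail\<close>
      counts. Inside, \<open>trunc i\<close> agrees with \<open>trunc J\<close> once
      \<open>i \<ge> J\<close>; the fewer than \<open>J\<close> earlier indices cost at most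
      \<open>K\<close> each, a total that the second assumption on \<open>n\<close> absorbs.\<close>
    have pw: "norm (trunc i x - s x) powr p
        \<le> norm (trunc J x - s x) powr p + tail x + (if i < J then K else 0)" if i: "i \<in> {1..n}" for i x
    proof (cases "norm x \<le> B")
      case True
      show ?thesis
      proof (cases "i < J")
        case True
        then have "norm (trunc i x - s x) \<le> 3 * B"
          using z_bd[of i x] b_mono[of i J] i by (simp add: B_def)
        then have "norm (trunc i x - s x) powr p \<le> K"
          unfolding K_def using p_ge_1 by (intro powr_mono2) auto
        then show ?thesis using True by (simp add: tail_def add_increasing)
      next
        case False
        then have "trunc i x = trunc J x"
          using True b_mono[of J i] J by (simp add: trunc_def B_def)
        then show ?thesis using False by (simp add: tail_def)
      qed
    next
      case False
      then have "norm (trunc i x - s x) powr p \<le> tail x"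
        using s_0[of x] b_mono[of i n] i p_ge_1 by (auto simp: trunc_def tail_def)
      then show ?thesis by (simp add: add_increasing2 add_increasing K_def)
    qed
    have int_p: "integrable M (\<lambda>\<omega>. norm (trunc i (X \<omega>) - s (X \<omega>)) powr p)" if "i \<ge> 1" for i
      using that p_ge_1 z_bd by (intro integrable_of_X[of _ "(b i + 2 * B) powr p"]) (auto intro!: powr_mono2)
    have int_tail: "integrable M (\<lambda>\<omega>. tail (X \<omega>))"
      by (rule integrable_of_X[OF _ tail_bd]) simp
    have tail_le: "real n * expectation (\<lambda>\<omega>. tail (X \<omega>)) \<le> \<theta> * b n powr p"
    proof -
      have "real n * expectation (\<lambda>\<omega>. tail (X \<omega>)) = expectation (\<lambda>\<omega>. real n * tail (X \<omega>))"
        by simp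
      also have "\<dots> \<le> expectation (\<lambda>\<omega>. b n powr p * (if b J < norm (X \<omega>) then real (crossings (norm (X \<omega>))) + 1 else 0))"
      proof (rule integral_mono)
        have "integrable M (\<lambda>\<omega>. real (crossings (norm (X \<omega>))) + 1)"
          using crossings_integrable by simp
        then have "integrable M (\<lambda>\<omega>. if b J < norm (X \<omega>) then real (crossings (norm (X \<omega>))) + 1 else 0)"
          by (rule Bochner_Integration.integrable_bound) auto
        then show "integrable M (\<lambda>\<omega>. b n powr p * (if b J < norm (X \<omega>) then real (crossings (norm (X \<omega>))) + 1 else 0))"
          by simp
        show "real n * tail (X \<omega>) \<le> b n powr p * (if b J < norm (X \<omega>) then real (crossings (norm (X \<omega>))) + 1 else 0)" for \<omega>
          using mult_powr_le_crossings[of "norm (X \<omega>)" n] n1 by (auto simp: tail_def B_def mult.commute)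
      qed (use int_tail in simp)
      also have "\<dots> = b n powr p * G J" by (simp add: G_def)
      also have "\<dots> \<le> b n powr p * \<theta>" using J by (intro mult_left_mono) auto
      finally show ?thesis by (simp add: mult.commute)
    qed
    have "(\<Sum>i=1..n. expectation (\<lambda>\<omega>. norm (trunc i (X \<omega>) - s (X \<omega>)) powr p))
        \<le> (\<Sum>i=1..n. \<theta> * b 1 powr p + expectation (\<lambda>\<omega>. tail (X \<omega>)) + (if i < J then K else 0))"
    proof (rule sum_mono)
      fix i assume i: "i \<in> {1..n}"
      have "expectation (\<lambda>\<omega>. norm (trunc i (X \<omega>) - s (X \<omega>)) powr p)
          \<le> expectation (\<lambda>\<omega>. norm (trunc J (X \<omega>) - s (X \<omega>)) powr p + tail (X \<omega>) + (if i < J then K else 0))"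
        using i J by (intro integral_mono pw int_p Bochner_Integration.integrable_add int_tail) auto
      also have "\<dots> = expectation (\<lambda>\<omega>. norm (trunc J (X \<omega>) - s (X \<omega>)) powr p) + expectation (\<lambda>\<omega>. tail (X \<omega>)) + (if i < J then K else 0)"
        using int_p[OF J(2)] int_tail by (simp add: prob_space)
      finally show "expectation (\<lambda>\<omega>. norm (trunc i (X \<omega>) - s (X \<omega>)) powr p)
          \<le> \<theta> * b 1 powr p + expectation (\<lambda>\<omega>. tail (X \<omega>)) + (if i < J then K else 0)"
        using s_approx by linarith
    qed
    also have "\<dots> = real n * (\<theta> * b 1 powr p) + real n * expectation (\<lambda>\<omega>. tail (X \<omega>)) + (\<Sum>i=1..n. if i < J then K else 0)"
      by (simp add: sum.distrib distrib_left)
    also have "(\<Sum>i=1..n. if i < J then K else 0) \<le> real J * K"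
    proof -
      have "(\<Sum>i=1..n. if i < J then K else 0) = real (card {i\<in>{1..n}. i < J}) * K"
        by (simp add: sum.If_cases Int_def)
      also have "\<dots> \<le> real (card {..<J}) * K"
        by (intro mult_right_mono of_nat_mono card_mono) (auto simp: K_def)
      finally show ?thesis by simp
    qed
    also have "real n * (\<theta> * b 1 powr p) \<le> \<theta> * b n powr p"
      using b_growth_1_powr[OF n1] \<theta> by (simp add: mult.left_commute mult.commute mult_le_cancel_left_pos)
    finally have moments: "(\<Sum>i=1..n. expectation (\<lambda>\<omega>. norm (trunc i (X \<omega>) - s (X \<omega>)) powr p)) \<le> 3 * \<theta> * b n powr p"
      using tail_le n(2) by linarith
    define Z where "Z i \<omega> = trunc i (Xs i \<omega>) - s (Xs i \<omega>)" for i \<omega>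
    define W where "W i \<omega> = s (Xs i \<omega>)" for i \<omega>
    have intZ: "integrable M (Z i)" if "i \<in> {1..n}" for i
      unfolding Z_def[abs_def] using that z_bd by (intro integrable_of_Xs[of _ _ "b i + 2 * B"]) auto
    have intW: "integrable M (W i)" if "i \<in> {1..n}" for i
      unfolding W_def[abs_def] using that s_bd by (intro integrable_of_Xs[of _ _ "2 * B"]) auto
    have EZ: "expectation (\<lambda>\<omega>. norm (Z i \<omega>) powr p) = expectation (\<lambda>\<omega>. norm (trunc i (X \<omega>) - s (X \<omega>)) powr p)"
      if "i \<in> {1..n}" for i
      unfolding Z_def using that by (intro expectation_Xs[of _ "\<lambda>x. norm (trunc i x - s x) powr p"]) auto
    \<comment> \<open>The free parameter is taken as \<open>\<delta> * b n\<close>, which balances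
      the two terms of the bound.\<close>
    have "expectation (\<lambda>\<omega>. norm (\<Sum>i=1..n. Z i \<omega> - expectation (Z i)))
        \<le> 4 * (\<delta> * b n + (\<delta> * b n) powr (1 - p) * (C * (\<Sum>i=1..n. expectation (\<lambda>\<omega>. norm (Z i \<omega>) powr p))))"
    proof (rule expectation_norm_centered_sum_le[OF R \<open>0 < C\<close> C p_ge_1])
      show "indep_vars (\<lambda>_. borel) Z {1..n}"
        unfolding Z_def[abs_def] by (rule indep_of_Xs) simp
      show "norm (Z i \<omega>) \<le> b n + 2 * B" if "i \<in> {1..n}" for i \<omega>
        unfolding Z_def using z_bd[of i "Xs i \<omega>"] b_mono[of i n] that by auto
    qed (use \<delta> bn in simp)
    also have "(\<Sum>i=1..n. expectation (\<lambda>\<omega>. norm (Z i \<omega>) powr p)) \<le> 3 * \<theta> * b n powr p"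
      using moments EZ by simp
    also have "(\<delta> * b n) powr (1 - p) * (C * (3 * \<theta> * b n powr p)) = \<delta> * b n"
    proof -
      have "C * (3 * \<theta> * b n powr p) = (\<delta> * b n) powr p"
        using \<open>0 < C\<close> \<delta> bn by (simp add: \<theta>_def powr_mult)
      then show ?thesis
        using \<delta> bn by (simp add: powr_add[symmetric])
    qed
    finally have Zsum: "expectation (\<lambda>\<omega>. norm (\<Sum>i=1..n. Z i \<omega> - expectation (Z i))) \<le> 8 * \<delta> * b n"
      using \<delta> bn \<open>0 < C\<close> by (simp add: mult_left_mono)
    have Wsum: "expectation (\<lambda>\<omega>. norm (\<Sum>i=1..n. W i \<omega> - expectation (W i))) \<le> 2 * sqrt (real n) * c0"
      unfolding c0_def
    proof (rule expectation_norm_finite_range_sum_le[OF _ s_fin])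
      show "indep_vars (\<lambda>_. borel) W {1..n}"
        unfolding W_def[abs_def] by (rule indep_of_Xs) simp
    qed (simp add: W_def)
    have split: "centered_sum n \<omega> = (\<Sum>i=1..n. W i \<omega> - expectation (W i)) + (\<Sum>i=1..n. Z i \<omega> - expectation (Z i))" for \<omega>
      unfolding centered_sum_def sum.distrib[symmetric]
    proof (rule sum.cong[OF refl])
      fix i assume i: "i \<in> {1..n}"
      have "expectation (\<lambda>\<omega>. trunc i (X \<omega>)) = expectation (\<lambda>\<omega>. trunc i (Xs i \<omega>))"
        using i by (intro expectation_Xs[symmetric]) auto
      also have "\<dots> = expectation (\<lambda>\<omega>. W i \<omega> + Z i \<omega>)" by (simp add: W_def Z_def)
      also have "\<dots> = expectation (W i) + expectation (Z i)"
        using intW[OF i] intZ[OF i] by simp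
      finally show "trunc i (Xs i \<omega>) - expectation (\<lambda>\<omega>. trunc i (X \<omega>))
          = (W i \<omega> - expectation (W i)) + (Z i \<omega> - expectation (Z i))"
        by (simp add: W_def Z_def)
    qed
    have iZ: "integrable M (\<lambda>\<omega>. norm (\<Sum>i=1..n. Z i \<omega> - expectation (Z i)))"
      using intZ by (intro integrable_norm Bochner_Integration.integrable_sum Bochner_Integration.integrable_diff) auto
    have iW: "integrable M (\<lambda>\<omega>. norm (\<Sum>i=1..n. W i \<omega> - expectation (W i)))"
      using intW by (intro integrable_norm Bochner_Integration.integrable_sum Bochner_Integration.integrable_diff) auto
    have "expectation (\<lambda>\<omega>. norm (centered_sum n \<omega>))
        \<le> expectation (\<lambda>\<omega>. norm (\<Sum>i=1..n. W i \<omega> - expectation (W i)) + norm (\<Sum>i=1..n. Z i \<omega> - expectation (Z i)))"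
    proof (rule integral_mono)
      show le: "norm (centered_sum n \<omega>)
          \<le> norm (\<Sum>i=1..n. W i \<omega> - expectation (W i)) + norm (\<Sum>i=1..n. Z i \<omega> - expectation (Z i))" for \<omega>
        unfolding split by (rule norm_triangle_ineq)
      show i: "integrable M (\<lambda>\<omega>. norm (\<Sum>i=1..n. W i \<omega> - expectation (W i)) + norm (\<Sum>i=1..n. Z i \<omega> - expectation (Z i)))"
        using iW iZ by (rule Bochner_Integration.integrable_add)
      show "integrable M (\<lambda>\<omega>. norm (centered_sum n \<omega>))"
        by (rule Bochner_Integration.integrable_bound[OF i]) (use le in \<open>auto simp: abs_of_nonneg\<close>)
    qed
    also have "\<dots> = expectation (\<lambda>\<omega>. norm (\<Sum>i=1..n. W i \<omega> - expectation (W i)))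
        + expectation (\<lambda>\<omega>. norm (\<Sum>i=1..n. Z i \<omega> - expectation (Z i)))"
      using iW iZ by (rule Bochner_Integration.integral_add)
    finally show ?thesis using Wsum Zsum by linarith
  qed
  have "(\<lambda>n. 2 * c0 * (sqrt (real n) / b n)) \<longlonglongrightarrow> 2 * c0 * 0"
    by (intro tendsto_mult tendsto_const sqrt_over_b_tendsto_0)
  then have ev1: "eventually (\<lambda>n. 2 * c0 * (sqrt (real n) / b n) < \<epsilon> / 2) sequentially"
    using \<open>0 < \<epsilon>\<close> by (intro order_tendstoD(2)) auto
  have "eventually (\<lambda>n. real J * K / (\<theta> * b 1 powr p) \<le> real n) sequentially"
    using filterlim_real_sequentially by (simp add: filterlim_at_top)
  then have "eventually (\<lambda>n. norm (expectation (\<lambda>\<omega>. norm (centered_sum n \<omega>)) / b n - 0) < \<epsilon>) sequentially"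
    using ev1 eventually_ge_at_top[of J]
  proof eventually_elim
    case (elim n)
    have n1: "n \<ge> 1" using J elim by simp
    have bn: "b n > 0" using b_pos n1 by simp
    have "real J * K \<le> \<theta> * (b 1 powr p * real n)"
      using elim(1) \<open>0 < \<theta> * b 1 powr p\<close> by (simp add: field_simps)
    also have "\<dots> \<le> \<theta> * b n powr p"
      using b_growth_1_powr[OF n1] \<theta> by (intro mult_left_mono) auto
    finally have "expectation (\<lambda>\<omega>. norm (centered_sum n \<omega>)) \<le> 2 * sqrt (real n) * c0 + 8 * \<delta> * b n"
      by (intro main elim)
    then have "expectation (\<lambda>\<omega>. norm (centered_sum n \<omega>)) / b n \<le> (2 * sqrt (real n) * c0 + 8 * \<delta> * b n) / b n"
      using bn by (intro divide_right_mono) auto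
    also have "\<dots> = 2 * c0 * (sqrt (real n) / b n) + 8 * \<delta>"
      using bn by (simp add: add_divide_distrib)
    also have "\<dots> < \<epsilon>" using elim(2) by (simp add: \<delta>_def)
    finally show ?case using bn by (simp add: abs_of_nonneg)
  qed
  then show "\<exists>n0. \<forall>n\<ge>n0. norm (expectation (\<lambda>\<omega>. norm (centered_sum n \<omega>)) / b n - 0) < \<epsilon>"
    by (simp add: eventually_sequentially)
qed

end

section \<open>Strong law\<close>

context iid_norming_summable
begin

text \<open>Integrated form of the pointwise bound on square ratios; its uniformity in
  \<open>n\<close> later gives the summability of the block probabilities.\<close>

lemma sum_second_moments_le:
  "(\<Sum>i=1..n. expectation (\<lambda>\<omega>. (norm (trunc i (X \<omega>)))\<^sup>2) / (b i)\<^sup>2)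
    \<le> (1 + 1 / (2 / p - 1)) * (expectation (\<lambda>\<omega>. real (crossings (norm (X \<omega>)))) + 1)"
proof -
  have int: "integrable M (\<lambda>\<omega>. (norm (trunc i (X \<omega>)))\<^sup>2 / (b i)\<^sup>2)" if "i \<in> {1..n}" for i
  proof -
    have "norm ((norm (trunc i x))\<^sup>2 / (b i)\<^sup>2) \<le> (b i)\<^sup>2 / (b i)\<^sup>2" for x
      using norm_trunc_le[of i x] that by (simp add: divide_right_mono power_mono)
    then show ?thesis by (intro integrable_of_X[of "\<lambda>x. (norm (trunc i x))\<^sup>2 / (b i)\<^sup>2"]) auto
  qed
  have "(\<Sum>i=1..n. expectation (\<lambda>\<omega>. (norm (trunc i (X \<omega>)))\<^sup>2) / (b i)\<^sup>2)
      = expectation (\<lambda>\<omega>. \<Sum>i=1..n. (norm (trunc i (X \<omega>)))\<^sup>2 / (b i)\<^sup>2)"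
    using int by (subst Bochner_Integration.integral_sum) auto
  also have "\<dots> \<le> expectation (\<lambda>\<omega>. (1 + 1 / (2 / p - 1)) * (real (crossings (norm (X \<omega>))) + 1))"
  proof (rule integral_mono)
    show "integrable M (\<lambda>\<omega>. \<Sum>i=1..n. (norm (trunc i (X \<omega>)))\<^sup>2 / (b i)\<^sup>2)"
      by (rule Bochner_Integration.integrable_sum[OF int])
    show "integrable M (\<lambda>\<omega>. (1 + 1 / (2 / p - 1)) * (real (crossings (norm (X \<omega>))) + 1))"
      using crossings_integrable by simp
    have "(\<Sum>i=1..n. (norm (trunc i x))\<^sup>2 / (b i)\<^sup>2) = (\<Sum>i=1..n. if norm x \<le> b i then (norm x)\<^sup>2 / (b i)\<^sup>2 else 0)" for x :: 'b
      by (intro sum.cong) (auto simp: trunc_def)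
    then show "(\<Sum>i=1..n. (norm (trunc i (X \<omega>)))\<^sup>2 / (b i)\<^sup>2) \<le> (1 + 1 / (2 / p - 1)) * (real (crossings (norm (X \<omega>))) + 1)" for \<omega>
      using sum_square_ratio_le_crossings[of "norm (X \<omega>)" n] by simp
  qed
  also have "\<dots> = (1 + 1 / (2 / p - 1)) * (expectation (\<lambda>\<omega>. real (crossings (norm (X \<omega>)))) + 1)"
    using crossings_integrable by (simp add: prob_space)
  finally show ?thesis .
qed

text \<open>On an initial segment where \<open>b n < 2 ^ Suc k\<close>, Etemadi's inequality reduces
  the maximum to single sums, for which Chebyshev's inequality is effective because the weak law
  keeps the mean below half of the threshold \<open>\<epsilon> * 2 ^ k\<close>. The bounds are
  summable in \<open>k\<close>, so the first Borel-Cantelli lemma concludes.\<close>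

lemma AE_norm_centered_sum_le:
  assumes weak: "(\<lambda>n. expectation (\<lambda>\<omega>. norm (centered_sum n \<omega>)) / b n) \<longlonglongrightarrow> 0" and "0 < \<epsilon>"
  shows "AE \<omega> in M. eventually (\<lambda>n. norm (centered_sum n \<omega>) \<le> 3 * \<epsilon> * b n) sequentially"
proof -
  text \<open>Blocks are geometric in \<open>b\<close>, not in \<open>n\<close>, since \<open>b\<close> may grow arbitrarily fast.\<close>
  define D where "D k = crossings (2 ^ Suc k)" for k
  have D: "n \<le> D k \<longleftrightarrow> b n < 2 ^ Suc k" if "n \<ge> 1" for n k
    unfolding D_def using less_iff_le_crossings[OF that] by simp
  have D_mono: "D k \<le> D m" if "k \<le> m" for k m
  proof (cases "D k = 0")
    case False
    then have "b (D k) < 2 ^ Suc k" using D[of "D k" k] by simp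
    also have "\<dots> \<le> 2 ^ Suc m" using that by (intro power_increasing) auto
    finally show ?thesis using D[of "D k" m] False by simp
  qed simp
  define E where "E n = expectation (\<lambda>\<omega>. norm (centered_sum n \<omega>))" for n
  define a where "a i = expectation (\<lambda>\<omega>. (norm (trunc i (X \<omega>)))\<^sup>2)" for i
  have a0: "0 \<le> a i" for i unfolding a_def by simp
  have E0: "0 \<le> E n" for n unfolding E_def by simp
  \<comment> \<open>The bound is required for every \<open>n \<le> D k\<close>, not only for large
    \<open>n\<close>: the finitely many \<open>n < n0\<close> are dominated by taking
    \<open>k\<close> large, the others by the weak law and \<open>b n < 2 ^ Suc k\<close>.\<close>
  obtain k0 where k0: "\<And>k n. k \<ge> k0 \<Longrightarrow> n \<le> D k \<Longrightarrow> E n \<le> \<epsilon> / 2 * 2 ^ k"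
  proof -
    have "eventually (\<lambda>n. E n / b n < \<epsilon> / 4) sequentially"
      using order_tendstoD(2)[OF weak, of "\<epsilon> / 4"] \<open>0 < \<epsilon>\<close> by (simp add: E_def)
    then have "eventually (\<lambda>n. E n / b n < \<epsilon> / 4 \<and> n \<ge> 1) sequentially"
      using eventually_ge_at_top by (rule eventually_conj)
    then obtain n0 where n0: "\<And>n. n \<ge> n0 \<Longrightarrow> E n / b n < \<epsilon> / 4 \<and> n \<ge> 1"
      by (auto simp: eventually_sequentially)
    obtain k0 where k0: "(\<Sum>n<n0. E n) / (\<epsilon> / 2) < 2 ^ k0"
      using real_arch_pow[of 2] by auto
    show thesis
    proof (rule that)
      fix k n assume k: "k \<ge> k0" and n: "n \<le> D k"
      show "E n \<le> \<epsilon> / 2 * 2 ^ k"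
      proof (cases "n < n0")
        case True
        then have "E n \<le> (\<Sum>n<n0. E n)"
          using E0 by (intro member_le_sum) auto
        also have "\<dots> \<le> \<epsilon> / 2 * 2 ^ k0"
          using k0 \<open>0 < \<epsilon>\<close> by (simp add: field_simps)
        also have "\<dots> \<le> \<epsilon> / 2 * 2 ^ k"
          using k \<open>0 < \<epsilon>\<close> by (intro mult_left_mono power_increasing) auto
        finally show ?thesis .
      next
        case False
        then have n1: "n \<ge> 1" using n0 by simp
        have "E n \<le> \<epsilon> / 4 * b n"
          using n0[of n] b_pos[of n] False by (auto simp: field_simps)
        also have "\<epsilon> / 4 * b n \<le> \<epsilon> / 4 * 2 ^ Suc k"
          using D[OF n1] n \<open>0 < \<epsilon>\<close> by (intro mult_left_mono) auto
        finally show ?thesis by simp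
      qed
    qed
  qed
  define A where "A k = {\<omega>\<in>space M. \<exists>n\<le>D k. norm (centered_sum n \<omega>) > 3 * (\<epsilon> * 2 ^ k)}" for k
  define q where "q k = 4 / \<epsilon>\<^sup>2 * ((1/4) ^ k * (\<Sum>i=1..D k. a i))" for k
  have probA: "prob (A k) \<le> 3 * q k" if "k \<ge> k0" for k
    unfolding A_def centered_sum_def
  proof (rule etemadi_inequality)
    show "indep_vars (\<lambda>_. borel) (\<lambda>i \<omega>. trunc i (Xs i \<omega>) - expectation (\<lambda>\<omega>. trunc i (X \<omega>))) {1..D k}"
      by (rule indep_of_Xs[of "\<lambda>i x. trunc i x - expectation (\<lambda>\<omega>. trunc i (X \<omega>))"]) simp
    show "0 \<le> \<epsilon> * 2 ^ k" using \<open>0 < \<epsilon>\<close> by simp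
    fix n assume n: "n \<le> D k"
    let ?f = "\<lambda>\<omega>. norm (centered_sum n \<omega>)" and ?t = "\<epsilon> / 2 * 2 ^ k"
    have t: "0 < ?t" using \<open>0 < \<epsilon>\<close> by simp
    obtain K where K: "\<And>\<omega>. ?f \<omega> \<le> K" using norm_centered_sum_bounded by blast
    \<comment> \<open>The mean is at most half of the threshold, so exceeding the threshold is a
      deviation of at least the other half \<open>?t\<close>.\<close>
    have "prob {\<omega>\<in>space M. ?f \<omega> > \<epsilon> * 2 ^ k} \<le> prob {\<omega>\<in>space M. ?t \<le> \<bar>?f \<omega> - expectation ?f\<bar>}"
    proof (rule finite_measure_mono)
      have "expectation ?f \<le> ?t" using k0[OF that n] by (simp add: E_def)
      then have "?t \<le> \<bar>?f \<omega> - expectation ?f\<bar>" if "?f \<omega> > \<epsilon> * 2 ^ k" for \<omega>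
        using that by linarith
      then show "{\<omega>\<in>space M. ?f \<omega> > \<epsilon> * 2 ^ k} \<subseteq> {\<omega>\<in>space M. ?t \<le> \<bar>?f \<omega> - expectation ?f\<bar>}"
        by blast
    qed simp
    also have "\<dots> \<le> variance ?f / ?t\<^sup>2"
      using t by (intro Chebyshev_inequality integrable_bounded[of _ "K\<^sup>2"])
        (auto intro: power_mono K)
    also have "\<dots> \<le> (\<Sum>i=1..n. a i) / ?t\<^sup>2"
      unfolding a_def by (intro divide_right_mono variance_norm_centered_sum_le) simp
    also have "\<dots> \<le> (\<Sum>i=1..D k. a i) / ?t\<^sup>2"
      using n a0 by (intro divide_right_mono sum_mono2) auto
    also have "?t\<^sup>2 = \<epsilon>\<^sup>2 / 4 * 4 ^ k"
      by (simp add: power_mult_distrib power_divide power_mult[symmetric] power_even_eq mult.commute[of k 2] power_mult)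
    also have "(\<Sum>i=1..D k. a i) / (\<epsilon>\<^sup>2 / 4 * 4 ^ k) = q k"
      by (simp add: q_def power_divide)
    finally show "prob {\<omega>\<in>space M. norm (\<Sum>i=1..n. trunc i (Xs i \<omega>) - expectation (\<lambda>\<omega>. trunc i (X \<omega>))) > \<epsilon> * 2 ^ k} \<le> q k"
      by (simp add: centered_sum_def)
  qed
  have "summable (\<lambda>k. (1/4) ^ k * (\<Sum>i=1..D k. a i))"
  proof (rule summableI_nonneg_bounded)
    show "0 \<le> (1/4) ^ k * (\<Sum>i=1..D k. a i)" for k
      using a0 by (intro mult_nonneg_nonneg sum_nonneg) auto
    fix m
    \<comment> \<open>Index \<open>i\<close> lies in the \<open>k\<close>-th segment iff
      \<open>b i < 2 ^ Suc k\<close>. Extending every inner sum to the common range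
      \<open>{1..D m}\<close> permits exchanging the summations, and the dyadic sum over
      \<open>k\<close> is then of order \<open>1 / (b i)\<^sup>2\<close>.\<close>
    have "(\<Sum>k<m. (1/4) ^ k * (\<Sum>i=1..D k. a i))
        = (\<Sum>k<m. \<Sum>i=1..D m. a i * (if b i < 2 ^ Suc k then (1/4) ^ k else 0))"
    proof (rule sum.cong[OF refl])
      fix k assume "k \<in> {..<m}"
      then have "{1..D k} \<subseteq> {1..D m}" using D_mono[of k m] by auto
      then have "(\<Sum>i=1..D k. a i * (if b i < 2 ^ Suc k then (1/4) ^ k else 0))
          = (\<Sum>i=1..D m. a i * (if b i < 2 ^ Suc k then (1/4) ^ k else 0))"
        using D by (intro sum.mono_neutral_left) auto
      moreover have "(\<Sum>i=1..D k. a i * (if b i < 2 ^ Suc k then (1/4) ^ k else 0)) = (\<Sum>i=1..D k. a i * (1/4) ^ k)"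
        using D by (intro sum.cong) auto
      ultimately show "(1/4) ^ k * (\<Sum>i=1..D k. a i) = (\<Sum>i=1..D m. a i * (if b i < 2 ^ Suc k then (1/4) ^ k else 0))"
        by (simp add: sum_distrib_right mult.commute)
    qed
    also have "\<dots> = (\<Sum>i=1..D m. a i * (\<Sum>k<m. if b i < 2 ^ Suc k then (1/4) ^ k else 0))"
      by (subst sum.swap) (simp add: sum_distrib_left)
    also have "\<dots> \<le> (\<Sum>i=1..D m. a i * (16 / (3 * (b i)\<^sup>2)))"
      using a0 b_pos by (intro sum_mono mult_left_mono sum_dyadic_le) auto
    also have "\<dots> = 16 / 3 * (\<Sum>i=1..D m. a i / (b i)\<^sup>2)"
      unfolding sum_distrib_left by (intro sum.cong) auto
    also have "\<dots> \<le> 16 / 3 * ((1 + 1 / (2 / p - 1)) * (expectation (\<lambda>\<omega>. real (crossings (norm (X \<omega>)))) + 1))"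
      unfolding a_def by (intro mult_left_mono sum_second_moments_le) simp
    finally show "(\<Sum>k<m. (1/4) ^ k * (\<Sum>i=1..D k. a i)) \<le> \<dots>" .
  qed
  then have "summable (\<lambda>k. 3 * q k)"
    unfolding q_def by (intro summable_mult)
  moreover have "eventually (\<lambda>k. norm (prob (A k)) \<le> 3 * q k) sequentially"
    using eventually_ge_at_top[of k0] by eventually_elim (simp add: probA)
  ultimately have "summable (\<lambda>k. prob (A k))"
    by (rule summable_comparison_test_ev[rotated])
  moreover have "A k \<in> events" for k
    unfolding A_def by measurable
  ultimately have "AE \<omega> in M. eventually (\<lambda>k. \<omega> \<in> space M - A k) sequentially"
    by (intro borel_cantelli_AE1) (auto simp: emeasure_eq_measure)
  then show ?thesis
  proof eventually_elim
    case (elim \<omega>)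
    then obtain k1 where k1: "\<And>k. k \<ge> k1 \<Longrightarrow> \<omega> \<in> space M - A k"
      by (auto simp: eventually_sequentially)
    have "eventually (\<lambda>n. 2 ^ k1 \<le> b n) sequentially"
      using filterlim_b by (simp add: filterlim_at_top)
    then show ?case
      using eventually_ge_at_top[of 1]
    proof eventually_elim
      case (elim n)
      \<comment> \<open>This is the block with \<open>2 ^ k \<le> b n < 2 ^ Suc k\<close>; for
        \<open>k = 0\<close> the lower bound comes from
        \<open>b n \<ge> 2 ^ k1 \<ge> 1\<close>.\<close>
      define k where "k = (LEAST k. b n < 2 ^ Suc k)"
      obtain j where "b n < 2 ^ j" using real_arch_pow[of 2 "b n"] by auto
      also have "(2::real) ^ j \<le> 2 ^ Suc j" by (intro power_increasing) auto
      finally have k: "b n < 2 ^ Suc k" unfolding k_def by (rule LeastI)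
      with elim(1) have "(2::real) ^ k1 < 2 ^ Suc k" by linarith
      then have "k1 < Suc k" by (rule power_less_imp_less_exp[rotated]) simp
      then have "k \<ge> k1" by simp
      have "2 ^ k \<le> b n"
      proof (cases k)
        case 0
        have "1 \<le> (2::real) ^ k1" by simp
        then have "1 \<le> b n" using elim(1) by linarith
        then show ?thesis using 0 by simp
      next
        case (Suc l)
        then have "\<not> b n < 2 ^ Suc l"
          using not_less_Least[of l "\<lambda>k. b n < 2 ^ Suc k"] by (simp add: k_def)
        then show ?thesis using Suc by simp
      qed
      have "norm (centered_sum n \<omega>) \<le> 3 * (\<epsilon> * 2 ^ k)"
        using k1[OF \<open>k \<ge> k1\<close>] D[OF elim(2), of k] k by (auto simp: A_def not_less)
      also have "\<dots> \<le> 3 * (\<epsilon> * b n)"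
        using \<open>0 < \<epsilon>\<close> \<open>2 ^ k \<le> b n\<close> by (intro mult_left_mono) auto
      finally show ?case by simp
    qed
  qed
qed

lemma AE_centered_sum_tendsto_0:
  assumes "(\<lambda>n. expectation (\<lambda>\<omega>. norm (centered_sum n \<omega>)) / b n) \<longlonglongrightarrow> 0"
  shows "AE \<omega> in M. (\<lambda>n. centered_sum n \<omega> /\<^sub>R b n) \<longlonglongrightarrow> 0"
proof -
  have "AE \<omega> in M. \<forall>m. eventually (\<lambda>n. norm (centered_sum n \<omega>) \<le> 3 * inverse (real (Suc m)) * b n) sequentially"
    by (subst AE_all_countable) (intro allI AE_norm_centered_sum_le assms, simp)
  then show ?thesis
  proof eventually_elim
    case (elim \<omega>)
    show ?case
    proof (rule tendstoI)
      fix e :: real assume "0 < e"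
      then obtain m where m: "inverse (real (Suc m)) < e / 3"
        using reals_Archimedean[of "e / 3"] by auto
      from elim have "eventually (\<lambda>n. norm (centered_sum n \<omega>) \<le> 3 * inverse (real (Suc m)) * b n) sequentially"
        by blast
      then show "eventually (\<lambda>n. dist (centered_sum n \<omega> /\<^sub>R b n) 0 < e) sequentially"
        using eventually_ge_at_top[of 1]
      proof eventually_elim
        case (elim n)
        have bn: "b n > 0" using b_pos elim by simp
        have "norm (centered_sum n \<omega>) < e * b n"
          using elim(1) mult_strict_right_mono[OF m bn] by linarith
        then show ?case using bn by (simp add: field_simps)
      qed
    qed
  qed
qed

text \<open>The deviation splits into truncation errors, the centered truncated sum and the drift of
  the means. By the first Borel-Cantelli lemma, almost surely only finitely many truncation errors
  are nonzero, so their sum disappears after division by \<open>b n\<close>.\<close>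

lemma AE_strong_law:
  assumes "(\<lambda>n. expectation (\<lambda>\<omega>. norm (centered_sum n \<omega>)) / b n) \<longlonglongrightarrow> 0"
  shows "AE \<omega> in M. (\<lambda>n. (partial_sum Xs n \<omega> - centering M X b n) /\<^sub>R b n) \<longlonglongrightarrow> 0"
proof -
  define A where "A n = {\<omega> \<in> space M. b (Suc n) < norm (Xs (Suc n) \<omega>)}" for n
  have [measurable]: "Xs (Suc n) \<in> borel_measurable M" for n
    by (rule Xs_measurable) simp
  have pA: "emeasure M (A n) = emeasure M {\<omega> \<in> space M. b (Suc n) < norm (X \<omega>)}" for n
  proof -
    have "prob (Xs (Suc n) -` {x. b (Suc n) < norm x} \<inter> space M) = prob (X -` {x. b (Suc n) < norm x} \<inter> space M)"
      by (rule prob_Xs) (auto intro!: open_Collect_less continuous_intros)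
    moreover have "Xs (Suc n) -` {x. b (Suc n) < norm x} \<inter> space M = A n"
      "X -` {x. b (Suc n) < norm x} \<inter> space M = {\<omega> \<in> space M. b (Suc n) < norm (X \<omega>)}"
      by (auto simp: A_def)
    ultimately show ?thesis by (simp add: emeasure_eq_measure)
  qed
  have "(\<Sum>n. emeasure M (A n)) < \<infinity>"
    using crossings_integrable unfolding integrable_crossings_iff pA .
  then have "summable (\<lambda>n. prob (A n))"
    unfolding emeasure_eq_measure by (intro summable_suminf_not_top) (auto simp: less_top)
  then have "AE \<omega> in M. eventually (\<lambda>n. \<omega> \<in> space M - A n) sequentially"
    by (intro borel_cantelli_AE1) (auto simp: A_def emeasure_eq_measure)
  with AE_centered_sum_tendsto_0[OF assms] show ?thesis
  proof eventually_elim
    case (elim \<omega>)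
    define r where "r i = Xs i \<omega> - trunc i (Xs i \<omega>)" for i
    from elim(2) have "eventually (\<lambda>n. r (Suc n) = 0) sequentially"
      by eventually_elim (auto simp: A_def r_def trunc_def)
    then obtain n0 where n0: "\<And>n. n \<ge> n0 \<Longrightarrow> r (Suc n) = 0"
      by (auto simp: eventually_sequentially)
    have r0: "r i = 0" if "i > n0" for i
      using n0[of "i - 1"] that by simp
    have "eventually (\<lambda>n. (\<Sum>i=1..n. r i) = (\<Sum>i=1..n0. r i)) sequentially"
      using eventually_ge_at_top[of n0]
    proof eventually_elim
      case (elim n)
      then show ?case by (intro sum.mono_neutral_right) (auto intro: r0)
    qed
    then have "eventually (\<lambda>n. (\<Sum>i=1..n. r i) /\<^sub>R b n = inverse (b n) *\<^sub>R (\<Sum>i=1..n0. r i)) sequentially"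
      by eventually_elim simp
    moreover have "(\<lambda>n. inverse (b n) *\<^sub>R (\<Sum>i=1..n0. r i)) \<longlonglongrightarrow> 0 *\<^sub>R (\<Sum>i=1..n0. r i)"
      by (intro tendsto_scaleR tendsto_const tendsto_inverse_0_at_top filterlim_b)
    ultimately have "(\<lambda>n. (\<Sum>i=1..n. r i) /\<^sub>R b n) \<longlonglongrightarrow> 0 *\<^sub>R (\<Sum>i=1..n0. r i)"
      by (subst tendsto_cong)
    then have "(\<lambda>n. (\<Sum>i=1..n. r i) /\<^sub>R b n) \<longlonglongrightarrow> 0"
      by simp
    from tendsto_add[OF tendsto_add[OF this elim(1)] mean_drift_tendsto_0]
    have "(\<lambda>n. (\<Sum>i=1..n. r i) /\<^sub>R b n + centered_sum n \<omega> /\<^sub>R b n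
        + ((\<Sum>i=1..n. expectation (\<lambda>\<omega>. trunc i (X \<omega>))) - centering M X b n) /\<^sub>R b n) \<longlonglongrightarrow> 0"
      by simp
    also have "(\<lambda>n. (\<Sum>i=1..n. r i) /\<^sub>R b n + centered_sum n \<omega> /\<^sub>R b n
        + ((\<Sum>i=1..n. expectation (\<lambda>\<omega>. trunc i (X \<omega>))) - centering M X b n) /\<^sub>R b n)
        = (\<lambda>n. (partial_sum Xs n \<omega> - centering M X b n) /\<^sub>R b n)"
      by (simp add: fun_eq_iff scaleR_add_right[symmetric] r_def centered_sum_def partial_sum_def sum_subtractf)
    finally show ?case .
  qed
qed

end

section \<open>Divergence\<close>

text \<open>With \<open>m = crossings (x / L) + 1\<close>, growth gives
  \<open>b (k * m) \<ge> k powr (1 / p) * b m \<ge> L * b m \<ge> x\<close>. Hence integrability of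
  \<open>crossings\<close> at a rescaled norm carries over to the norm itself.\<close>

lemma (in norming_sequence) crossings_le_crossings_scaled:
  assumes "1 \<le> L" "L powr p \<le> real k"
  shows "crossings x \<le> k * (crossings (x / L) + 1)"
proof -
  let ?m = "crossings (x / L) + 1"
  have "1 \<le> L powr p" using assms p_ge_1 by (intro ge_one_powr_ge_zero) auto
  then have k: "k \<ge> 1" using assms by (cases k) auto
  have "x / L \<le> b ?m" using le_iff_crossings_less[of ?m "x / L"] by simp
  then have "x \<le> b ?m * L" using assms by (simp add: field_simps)
  also have "\<dots> \<le> b ?m * (real (k * ?m) / real ?m) powr (1 / p)"
  proof (rule mult_left_mono)
    have "L = (L powr p) powr (1 / p)" using assms p_ge_1 by (simp add: powr_powr)
    also have "\<dots> \<le> real k powr (1 / p)" using assms p_ge_1 by (intro powr_mono2) auto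
    also have "real k = real (k * ?m) / real ?m"
      unfolding of_nat_mult by (rule nonzero_mult_div_cancel_right[symmetric]) simp
    finally show "L \<le> (real (k * ?m) / real ?m) powr (1 / p)" .
    show "0 \<le> b ?m" using b_pos[of ?m] by simp
  qed
  also have "\<dots> \<le> b (k * ?m)"
    using mult_le_mono1[OF k, of ?m] by (intro b_growth) simp_all
  finally have "crossings x < k * ?m"
    using k by (subst le_iff_crossings_less[symmetric]) auto
  then show ?thesis by simp
qed

context iid_norming
begin

lemma tail_prob_tendsto_0: "(\<lambda>n. prob {\<omega> \<in> space M. norm (X \<omega>) > b n}) \<longlonglongrightarrow> 0"
proof -
  have "(\<lambda>n. expectation (\<lambda>\<omega>. indicator {\<omega> \<in> space M. norm (X \<omega>) > b n} \<omega> :: real)) \<longlonglongrightarrow> expectation (\<lambda>_. 0)"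
  proof (rule integral_dominated_convergence[where w = "\<lambda>_. 1"])
    have "eventually (\<lambda>n. (indicator {\<omega> \<in> space M. norm (X \<omega>) > b n} \<omega> :: real) = 0) sequentially" for \<omega>
    proof -
      have "eventually (\<lambda>n. norm (X \<omega>) \<le> b n) sequentially"
        using filterlim_b by (simp add: filterlim_at_top)
      then show ?thesis by eventually_elim simp
    qed
    then show "AE \<omega> in M. (\<lambda>n. indicator {\<omega> \<in> space M. norm (X \<omega>) > b n} \<omega> :: real) \<longlonglongrightarrow> 0"
      by (intro AE_I2 tendsto_eventually)
  qed (auto simp: indicator_def)
  then show ?thesis by simp
qed

text \<open>For large \<open>n\<close> some point satisfies both \<open>\<parallel>X - c\<^sub>n\<parallel> \<le> 2 K b\<^sub>n\<close> and \<open>\<parallel>X\<parallel> \<le> b\<^sub>n\<close>, since either condition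
  fails with probability less than \<open>1/2\<close>; hence \<open>\<parallel>c\<^sub>n\<parallel> \<le> (2 K + 1) b\<^sub>n\<close>.\<close>

lemma summable_shifted_tail_imp_integrable:
  fixes c :: "nat \<Rightarrow> 'b"
  assumes "0 \<le> K" and sum: "summable (\<lambda>n. prob {\<omega> \<in> space M. norm (X \<omega> - c n) > 2 * K * b n})"
  shows "integrable M (\<lambda>\<omega>. real (crossings (norm (X \<omega>))))"
proof -
  \<comment> \<open>\<open>L * b n\<close> is the sum of the deviation threshold
    \<open>2 * K * b n\<close> and the bound \<open>(2 * K + 1) * b n\<close> on the shift
    \<open>c n\<close>.\<close>
  define L where "L = 4 * K + 1"
  have L: "1 \<le> L" using assms by (simp add: L_def)
  have "eventually (\<lambda>n. prob {\<omega> \<in> space M. norm (X \<omega> - c n) > 2 * K * b n} < 1/2) sequentially"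
    using summable_LIMSEQ_zero[OF sum] by (rule order_tendstoD) simp
  moreover have "eventually (\<lambda>n. prob {\<omega> \<in> space M. norm (X \<omega>) > b n} < 1/2) sequentially"
    using tail_prob_tendsto_0 by (rule order_tendstoD) simp
  ultimately have "eventually (\<lambda>n. prob {\<omega> \<in> space M. norm (X \<omega>) > L * b n}
      \<le> prob {\<omega> \<in> space M. norm (X \<omega> - c n) > 2 * K * b n}) sequentially"
    using eventually_ge_at_top[of 1]
  proof eventually_elim
    case (elim n)
    let ?A = "{\<omega> \<in> space M. norm (X \<omega> - c n) > 2 * K * b n}" and ?B = "{\<omega> \<in> space M. norm (X \<omega>) > b n}"
    have "prob (?A \<union> ?B) \<le> prob ?A + prob ?B" by (intro measure_Un_le) auto
    then have "?A \<union> ?B \<noteq> space M" using elim prob_space by auto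
    then have "\<exists>\<omega>\<in>space M. \<omega> \<notin> ?A \<union> ?B" by blast
    then obtain \<omega> where "\<omega> \<in> space M" "norm (X \<omega> - c n) \<le> 2 * K * b n" "norm (X \<omega>) \<le> b n"
      by (auto simp: not_less)
    then have c: "norm (c n) \<le> (2 * K + 1) * b n"
      using norm_triangle_ineq2[of "c n" "X \<omega>"] by (simp add: norm_minus_commute algebra_simps)
    have "norm (X \<omega>' - c n) > 2 * K * b n" if "norm (X \<omega>') > L * b n" for \<omega>'
      using norm_triangle_ineq2[of "X \<omega>'" "c n"] c that by (simp add: L_def algebra_simps)
    then show ?case
      by (intro finite_measure_mono) auto
  qed
  then have "eventually (\<lambda>n. norm (prob {\<omega> \<in> space M. norm (X \<omega>) > L * b n})
      \<le> prob {\<omega> \<in> space M. norm (X \<omega> - c n) > 2 * K * b n}) sequentially"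
    by simp
  then have "summable (\<lambda>n. prob {\<omega> \<in> space M. norm (X \<omega>) > L * b n})"
    using sum by (rule summable_comparison_test_ev)
  then have sumL: "summable (\<lambda>n. prob {\<omega> \<in> space M. norm (X \<omega>) > L * b (Suc n)})"
    by (subst summable_Suc_iff)
  have "(\<integral>\<^sup>+\<omega>. ennreal (real (crossings (norm (X \<omega>) / L))) \<partial>M)
      = (\<Sum>n. \<integral>\<^sup>+\<omega>. indicator {b (Suc n)<..} (norm (X \<omega>) / L) \<partial>M)"
    by (simp add: suminf_crossings[symmetric] nn_integral_suminf)
  also have "\<dots> = (\<Sum>n. emeasure M {\<omega> \<in> space M. norm (X \<omega>) > L * b (Suc n)})"
  proof (rule suminf_cong)
    fix n
    have "(\<integral>\<^sup>+\<omega>. indicator {b (Suc n)<..} (norm (X \<omega>) / L) \<partial>M)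
        = (\<integral>\<^sup>+\<omega>. indicator {\<omega> \<in> space M. norm (X \<omega>) > L * b (Suc n)} \<omega> \<partial>M)"
      using L by (intro nn_integral_cong) (auto simp: indicator_def field_simps)
    then show "(\<integral>\<^sup>+\<omega>. indicator {b (Suc n)<..} (norm (X \<omega>) / L) \<partial>M)
        = emeasure M {\<omega> \<in> space M. norm (X \<omega>) > L * b (Suc n)}"
      by (simp add: nn_integral_indicator)
  qed
  also have "\<dots> < \<infinity>"
    using sumL unfolding emeasure_eq_measure by (simp add: suminf_ennreal2)
  finally have intL: "integrable M (\<lambda>\<omega>. real (crossings (norm (X \<omega>) / L)))"
    by (subst integrable_iff_bounded) auto
  obtain k :: nat where k: "L powr p \<le> real k" using real_arch_simple by blast
  show ?thesis
  proof (rule Bochner_Integration.integrable_bound)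
    show "integrable M (\<lambda>\<omega>. real k * (real (crossings (norm (X \<omega>) / L)) + 1))"
      using intL by simp
    have "real (crossings x) \<le> real k * (real (crossings (x / L)) + 1)" for x
      using of_nat_mono[OF crossings_le_crossings_scaled[OF L k, of x], where 'a = real]
      by (simp add: algebra_simps)
    then show "AE \<omega> in M. norm (real (crossings (norm (X \<omega>)))) \<le> norm (real k * (real (crossings (norm (X \<omega>) / L)) + 1))"
      by (intro AE_I2) (simp add: abs_of_nonneg)
  qed simp
qed

text \<open>Bounds by \<open>K * b\<close> on two consecutive deviations force
  \<open>norm (Xs n \<omega> - c n) \<le> 2 * K * b n\<close>. The probabilities of the opposite
  event are not summable, as \<open>crossings\<close> would otherwise be integrable, so the second
  Borel-Cantelli lemma gives infinitely many violations.\<close>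

lemma AE_frequently_large:
  assumes "\<not> integrable M (\<lambda>\<omega>. real (crossings (norm (X \<omega>))))" and "0 \<le> K"
  shows "AE \<omega> in M. \<exists>\<^sub>\<infinity>n. norm (partial_sum Xs n \<omega> - centering M X b n) > K * b n"
proof -
  define c where "c n = centering M X b n - centering M X b (n - 1)" for n
  define A where "A n = {x. norm (x - c n) > 2 * K * b n}" for n
  have A: "A n \<in> sets borel" for n
    unfolding A_def by measurable
  have eq: "prob (Xs n -` A n \<inter> space M) = prob {\<omega> \<in> space M. norm (X \<omega> - c n) > 2 * K * b n}" if "n \<ge> 1" for n
  proof -
    have "X -` A n \<inter> space M = {\<omega> \<in> space M. norm (X \<omega> - c n) > 2 * K * b n}"
      by (auto simp: A_def)
    then show ?thesis using prob_Xs[OF that A] by simp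
  qed
  have "\<not> summable (\<lambda>n. prob (Xs n -` A n \<inter> space M))"
  proof
    assume "summable (\<lambda>n. prob (Xs n -` A n \<inter> space M))"
    moreover have "eventually (\<lambda>n. prob (Xs n -` A n \<inter> space M) = prob {\<omega> \<in> space M. norm (X \<omega> - c n) > 2 * K * b n}) sequentially"
      using eventually_ge_at_top[of 1] by eventually_elim (rule eq)
    ultimately have "summable (\<lambda>n. prob {\<omega> \<in> space M. norm (X \<omega> - c n) > 2 * K * b n})"
      by (simp add: summable_cong)
    then show False
      using summable_shifted_tail_imp_integrable[OF \<open>0 \<le> K\<close>] assms by blast
  qed
  then have "AE \<omega> in M. \<exists>\<^sub>\<infinity>n. Xs n \<omega> \<in> A n"
    using A by (intro borel_cantelli_2[OF indep_Xs]) auto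
  then show ?thesis
  proof eventually_elim
    case (elim \<omega>)
    show ?case
    proof (rule ccontr)
      define D where "D n = partial_sum Xs n \<omega> - centering M X b n" for n
      assume "\<not> (\<exists>\<^sub>\<infinity>n. norm (partial_sum Xs n \<omega> - centering M X b n) > K * b n)"
      then obtain n0 where n0: "\<And>n. n \<ge> n0 \<Longrightarrow> norm (D n) \<le> K * b n"
        by (auto simp: INFM_nat_le D_def not_less)
      \<comment> \<open>The offset 2 ensures \<open>n - 1 \<ge> 1\<close> as well as
        \<open>n - 1 \<ge> n0\<close>, so that \<open>b (n - 1) \<le> b n\<close> is
        available.\<close>
      obtain n where n: "n \<ge> n0 + 2" "Xs n \<omega> \<in> A n"
        using elim unfolding INFM_nat_le by blast
      have "Xs n \<omega> = partial_sum Xs n \<omega> - partial_sum Xs (n - 1) \<omega>"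
        using n by (cases n) (simp_all add: partial_sum_def)
      then have "Xs n \<omega> - c n = D n - D (n - 1)"
        by (simp add: c_def D_def)
      then have "norm (Xs n \<omega> - c n) \<le> norm (D n) + norm (D (n - 1))"
        using norm_triangle_ineq4 by metis
      also have "\<dots> \<le> K * b n + K * b (n - 1)"
        using n by (intro add_mono n0) auto
      also have "\<dots> \<le> 2 * K * b n"
        using b_mono[of "n - 1" n] n \<open>0 \<le> K\<close> by (simp add: mult_left_mono)
      finally show False using n by (simp add: A_def)
    qed
  qed
qed

text \<open>Integer values of \<open>K\<close> suffice, so the exceptional null sets can be united
  into one.\<close>

lemma AE_limsup_infinite:
  assumes "\<not> integrable M (\<lambda>\<omega>. real (crossings (norm (X \<omega>))))"
  shows "AE \<omega> in M. limsup (\<lambda>n. ereal (norm (partial_sum Xs n \<omega> - centering M X b n) / b n)) = \<infinity>"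
proof -
  have "AE \<omega> in M. \<forall>K::nat. \<exists>\<^sub>\<infinity>n. norm (partial_sum Xs n \<omega> - centering M X b n) > real K * b n"
    by (subst AE_all_countable) (intro allI AE_frequently_large assms, simp)
  then show ?thesis
  proof eventually_elim
    case (elim \<omega>)
    let ?f = "\<lambda>n. norm (partial_sum Xs n \<omega> - centering M X b n) / b n"
    show ?case
    proof (rule ccontr)
      assume "limsup (\<lambda>n. ereal (?f n)) \<noteq> \<infinity>"
      then obtain K :: nat where "limsup (\<lambda>n. ereal (?f n)) < ereal (real K)"
        using less_PInf_Ex_of_nat by auto
      then have "eventually (\<lambda>n. ereal (?f n) < ereal (real K)) sequentially"
        by (rule Limsup_lessD)
      then have "eventually (\<lambda>n. \<not> norm (partial_sum Xs n \<omega> - centering M X b n) > real K * b n) sequentially"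
        using eventually_ge_at_top[of 1]
        by eventually_elim (use b_pos in \<open>auto simp: field_simps\<close>)
      then show False
        using elim by (simp add: frequently_def cofinite_eq_sequentially)
    qed
  qed
qed

end

theorem corollary1p4:
  fixes N :: "'w measure" and R :: "nat \<Rightarrow> 'w \<Rightarrow> real"
    and M :: "'a measure"
    and X :: "'a \<Rightarrow> 'b::{banach, second_countable_topology}"
    and Xs :: "nat \<Rightarrow> 'a \<Rightarrow> 'b"
    and b :: "nat \<Rightarrow> real" and p :: real
  assumes "1 \<le> p" and "p < 2"
    and "\<And>n. n \<ge> 1 \<Longrightarrow> b n > 0"
    and "strict_mono_on {1..} b"
    and "mono_on {1..} (\<lambda>n. b n / real n powr (1 / p))"
    and "rademacher_sequence N R"
    and "rademacher_type N R TYPE('b) p"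
    and "iid_sequence M X Xs"
  shows
    "((AE \<omega> in M. (\<lambda>n. (partial_sum Xs n \<omega> - centering M X b n) /\<^sub>R b n) \<longlonglongrightarrow> 0)
       \<longleftrightarrow> (\<Sum>n. emeasure M {\<omega> \<in> space M. norm (X \<omega>) > b (Suc n)}) < \<infinity>)
     \<and>
     ((AE \<omega> in M. limsup (\<lambda>n. ereal (norm (partial_sum Xs n \<omega> - centering M X b n) / b n)) = \<infinity>)
       \<longleftrightarrow> (\<Sum>n. emeasure M {\<omega> \<in> space M. norm (X \<omega>) > b (Suc n)}) = \<infinity>)"
proof -
  interpret prob_space M
    using assms(8) by (simp add: iid_sequence_def)
  interpret iid_norming b p M X Xs
    by unfold_locales (fact assms)+
  let ?lim = "\<lambda>\<omega>. (\<lambda>n. (partial_sum Xs n \<omega> - centering M X b n) /\<^sub>R b n) \<longlonglongrightarrow> 0"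
  let ?sup = "\<lambda>\<omega>. limsup (\<lambda>n. ereal (norm (partial_sum Xs n \<omega> - centering M X b n) / b n)) = \<infinity>"
  have exclusive: "\<not> (?lim \<omega> \<and> ?sup \<omega>)" for \<omega>
  proof
    assume *: "?lim \<omega> \<and> ?sup \<omega>"
    have "(\<lambda>n. norm ((partial_sum Xs n \<omega> - centering M X b n) /\<^sub>R b n)) \<longlonglongrightarrow> 0"
      using * by (intro tendsto_norm_zero) simp
    moreover have "eventually (\<lambda>n. norm ((partial_sum Xs n \<omega> - centering M X b n) /\<^sub>R b n)
        = norm (partial_sum Xs n \<omega> - centering M X b n) / b n) sequentially"
      using eventually_ge_at_top[of 1]
    proof eventually_elim
      case (elim n)
      then show ?case using b_pos[of n] by (simp add: divide_inverse mult.commute)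
    qed
    ultimately have "(\<lambda>n. norm (partial_sum Xs n \<omega> - centering M X b n) / b n) \<longlonglongrightarrow> 0"
      by (rule Lim_transform_eventually)
    then have "limsup (\<lambda>n. ereal (norm (partial_sum Xs n \<omega> - centering M X b n) / b n)) = ereal 0"
      by (intro lim_imp_Limsup tendsto_ereal) simp_all
    with * show False by simp
  qed
  \<comment> \<open>On a probability space two mutually exclusive properties cannot both hold almost
    surely. Since the series is either finite or infinite, this turns one implication each for the
    limit and the limsup into the two equivalences.\<close>
  have not_both: "\<not> ((AE \<omega> in M. ?lim \<omega>) \<and> (AE \<omega> in M. ?sup \<omega>))"
  proof
    assume "(AE \<omega> in M. ?lim \<omega>) \<and> (AE \<omega> in M. ?sup \<omega>)"
    then have "AE \<omega> in M. ?lim \<omega> \<and> ?sup \<omega>" by simp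
    then have "AE \<omega> in M. False"
      by eventually_elim (use exclusive in blast)
    then show False by simp
  qed
  have lim: "AE \<omega> in M. ?lim \<omega>" if int: "integrable M (\<lambda>\<omega>. real (crossings (norm (X \<omega>))))"
  proof -
    interpret iid_norming_summable b p M X Xs
      by unfold_locales (fact int)
    obtain C where "0 < C"
      "\<And>n (v :: nat \<Rightarrow> 'b). (\<integral>\<^sup>+w. ennreal (norm (\<Sum>i=1..n. R i w *\<^sub>R v i) powr p) \<partial>N)
        \<le> ennreal (C * (\<Sum>i=1..n. norm (v i) powr p))"
      using rademacher_type_finite[OF assms(6,7)] by blast
    then show ?thesis
      by (intro AE_strong_law expectation_centered_sum_tendsto_0[OF assms(6)])
  qed
  have sup: "AE \<omega> in M. ?sup \<omega>" if "\<not> integrable M (\<lambda>\<omega>. real (crossings (norm (X \<omega>))))"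
    using that by (rule AE_limsup_infinite)
  show ?thesis
    using not_both lim sup integrable_crossings_iff by (auto simp: less_top)
qed

end
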